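(* Let $\tilde f_t$ and $f_t$, $t\in[0,T]$, be the solutions on the torus $\mathbb{T}^d$, with the same initial datum $f_0$, of the homogeneous Landau equation $$\partial_t \tilde f_t = -\nabla\cdot(\tilde f_t\, U[\tilde f_t]),\qquad U[\tilde f_t](v) = -\int_{\mathbb{T}^d} A(v-v_* )\big(\nabla\log\tilde f_t(v)-\nabla\log\tilde f_t(v_* )\big)\tilde f_t(v_* )\,dv_*,$$ and of the score-based Landau equation $$\partial_t f_t = -\nabla\cdot(f_t\,U^\delta),\qquad U^\delta(v) = -\int_{\mathbb{T}^d} A(v-v_* )\big(s_t(v)-s_t(v_* )\big) f_t(v_* )\,dv_*,$$ respectively, where $s_t:\mathbb{T}^d\to\mathbb{R}^d$ is a given time-dependent vector field (an approximation of the score). Assume: (i) $\lambda_1 I_d\preceq A(z)\preceq\lambda_2 I_d$ for all $z$, with constants $0<\lambda_1\le\lambda_2$; (ii) $f_0\ge 0$, $f_0\in W^{2,\infty}(\mathbb{T}^d)$, $\int_{\mathbb{T}^d} f_0\,dv=1$; and both $\tilde f_t$ and $f_t$ belong to $L^\infty([0,T],W^{2,\infty}(\mathbb{T}^d))$, are nonnegative, and have integral $1$ over $\mathbb{T}^d$ for all $t\in[0,T]$; (iii) $\sup_{(v,t)\in\mathbb{T}^d\times[0,T]}|\nabla\log\tilde f_t(v)|\le M$ for some constant $M$. Then, for $t\in[0,T]$, $$\frac{d}{dt}D_{\mathrm{KL}}(f_t\,\|\,\tilde f_t)\le C\,D_{\mathrm{KL}}(f_t\,\|\,\tilde f_t)+\frac{4d^2}{\lambda_1}\|A\|_{L^\infty}^2\int_{\mathbb{T}^d}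 f_t\,|\delta_t|^2\,dv,$$ where $\delta_t(v):=\nabla\log f_t(v)-s_t(v)$ is the score-matching error and $$C:=\frac{2d}{\lambda_1}\|\nabla\cdot A\|_{L^\infty}^2+M^2\,\frac{2d^2}{\lambda_1}\|A\|_{L^\infty}^2$$ is a constant that does not depend on $f_t$ and $\tilde f_t$ (other than through the bound $M$).
   Context: $d\ge 2$; $\nabla=\nabla_v$; $|\cdot|$ is the Euclidean norm. $A$ is the collision kernel, a function on $\mathbb{T}^d$ with values in symmetric $d\times d$ matrices, which is bounded and has bounded divergence $\nabla\cdot A$, where the divergence of a matrix function is applied row-wise: $(\nabla\cdot A)_i=\sum_j\partial_j A_{ij}$. The $L^\infty$ norm of a matrix- or vector-valued function is the maximum over entries of the $L^\infty$ norms of the entries: $\|A\|_{L^\infty}=\max_{i,j}\|A_{ij}\|_{L^\infty(\mathbb{T}^d)}$, $\|\nabla\cdot A\|_{L^\infty}=\max_i\|(\nabla\cdot A)_i\|_{L^\infty(\mathbb{T}^d)}$. The Kullback–Leibler divergence is $D_{\mathrm{KL}}(f\,\|\,g)=\int_{\mathbb{T}^d} f\log(f/g)\,dv$. The densities $f_t,\tilde f_t$ are positive, so that the logarithms make sense, and the solutions, $A$ and $s_t$ are regular enough that the equations hold, $t\mapsto D_{\mathrm{KL}}(f_t\|\tilde f_t)$ can be differentiated under the integral sign, and integration by parts on $\mathbb{T}^d$ is valid. *)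

theory Defs
  imports "HOL-Analysis.Analysis" "HOL-Probability.Essential_Supremum"
begin

text \<open>
  The torus is \<open>R^d / Z^d\<close> with \<open>d = CARD('n)\<close>: a function on it is a \<open>Z^d\<close>-periodic function
  on \<open>real ^ 'n\<close>, integrated over the unit cube.
\<close>

definition periodic :: "(real ^ 'n \<Rightarrow> 'b) \<Rightarrow> bool" where
  "periodic f \<longleftrightarrow> (\<forall>x i. f (x + axis i 1) = f x)"

definition torus :: "(real ^ 'n) measure" where
  "torus = restrict_space lborel (cbox 0 1)"

definition grad :: "(real ^ 'n \<Rightarrow> real) \<Rightarrow> real ^ 'n \<Rightarrow> real ^ 'n" where
  "grad f x = (\<chi> i. frechet_derivative f (at x) (axis i 1))"

definition C1_torus :: "(real ^ 'n \<Rightarrow> real) \<Rightarrow> bool" where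
  "C1_torus f \<longleftrightarrow> periodic f \<and> (\<forall>x. f differentiable (at x)) \<and> continuous_on UNIV (grad f)"

definition L1_torus :: "(real ^ 'n \<Rightarrow> 'b :: {banach, second_countable_topology}) \<Rightarrow> bool" where
  "L1_torus f \<longleftrightarrow> periodic f \<and> f \<in> borel_measurable borel \<and> integrable torus f"

definition L2_torus :: "(real ^ 'n \<Rightarrow> 'b :: {banach, second_countable_topology}) \<Rightarrow> bool" where
  "L2_torus f \<longleftrightarrow> periodic f \<and> f \<in> borel_measurable borel \<and> integrable torus (\<lambda>x. (norm (f x))\<^sup>2)"

definition Linf_le :: "real \<Rightarrow> (real ^ 'n \<Rightarrow> real) \<Rightarrow> bool" where
  "Linf_le K f \<longleftrightarrow> periodic f \<and> f \<in> borel_measurable borel \<and> (AE x in torus. \<bar>f x\<bar> \<le> K)"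

definition Linf_torus :: "(real ^ 'n \<Rightarrow> real) \<Rightarrow> bool" where
  "Linf_torus f \<longleftrightarrow> (\<exists>K. Linf_le K f)"

definition Linf_norm :: "(real ^ 'n \<Rightarrow> real) \<Rightarrow> real" where
  "Linf_norm f = real_of_ereal (esssup torus (\<lambda>x. ereal \<bar>f x\<bar>))"

definition vec_Linf_norm :: "(real ^ 'n \<Rightarrow> real ^ 'n) \<Rightarrow> real" where
  "vec_Linf_norm F = Max (range (\<lambda>i. Linf_norm (\<lambda>x. F x $ i)))"

definition mat_Linf_norm :: "(real ^ 'n \<Rightarrow> real ^ 'n ^ 'n) \<Rightarrow> real" where
  "mat_Linf_norm A = Max (range (\<lambda>(i, j). Linf_norm (\<lambda>x. A x $ i $ j)))"

text \<open>
  Derivatives in space are taken in the weak sense, tested against \<open>C^1\<close> functions on the torus;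
  there is no boundary term. A classical derivative of a \<open>C^1\<close> function is a weak one.
\<close>

definition weak_partial :: "'n \<Rightarrow> (real ^ 'n \<Rightarrow> real) \<Rightarrow> (real ^ 'n \<Rightarrow> real) \<Rightarrow> bool" where
  "weak_partial i f g \<longleftrightarrow> L1_torus f \<and> L1_torus g \<and>
     (\<forall>\<phi>. C1_torus \<phi> \<longrightarrow>
        (LINT x|torus. f x * grad \<phi> x $ i) = - (LINT x|torus. g x * \<phi> x))"

definition weak_div :: "(real ^ 'n \<Rightarrow> real ^ 'n) \<Rightarrow> (real ^ 'n \<Rightarrow> real) \<Rightarrow> bool" where
  "weak_div F g \<longleftrightarrow> L1_torus F \<and> L1_torus g \<and>
     (\<forall>\<phi>. C1_torus \<phi> \<longrightarrow>
        (LINT x|torus. F x \<bullet> grad \<phi> x) = - (LINT x|torus. g x * \<phi> x))"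

definition weak_div_rows ::
    "(real ^ 'n \<Rightarrow> real ^ 'n ^ 'n) \<Rightarrow> (real ^ 'n \<Rightarrow> real ^ 'n) \<Rightarrow> bool" where
  "weak_div_rows A B \<longleftrightarrow> (\<forall>i. weak_div (\<lambda>x. row i (A x)) (\<lambda>x. B x $ i))"

text \<open>
  \<open>W1inf_le K f\<close> and \<open>W2inf_le K f\<close>: \<open>f\<close> lies in \<open>W^{1,inf}\<close>, respectively \<open>W^{2,inf}\<close>, of the torus,
  with norm (the maximum of the \<open>L^inf\<close> norms of all weak derivatives up to that order) at most \<open>K\<close>.
\<close>

definition W1inf_le :: "real \<Rightarrow> (real ^ 'n \<Rightarrow> real) \<Rightarrow> bool" where
  "W1inf_le K f \<longleftrightarrow> Linf_le K f \<and> (\<exists>G. \<forall>i. weak_partial i f (G i) \<and> Linf_le K (G i))"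

definition W2inf_le :: "real \<Rightarrow> (real ^ 'n \<Rightarrow> real) \<Rightarrow> bool" where
  "W2inf_le K f \<longleftrightarrow> Linf_le K f \<and> (\<exists>G. \<forall>i. weak_partial i f (G i) \<and> W1inf_le K (G i))"

definition W2inf_torus :: "(real ^ 'n \<Rightarrow> real) \<Rightarrow> bool" where
  "W2inf_torus f \<longleftrightarrow> (\<exists>K. W2inf_le K f)"

text \<open>Essential boundedness in time; Bochner measurability in time is not required.\<close>

definition Linf_W2inf :: "real \<Rightarrow> (real \<Rightarrow> real ^ 'n \<Rightarrow> real) \<Rightarrow> bool" where
  "Linf_W2inf T f \<longleftrightarrow> (\<exists>K. AE t in lborel. t \<in> {0..T} \<longrightarrow> W2inf_le K (f t))"

text \<open>The Loewner order, for symmetric matrices.\<close>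

definition loewner_le :: "real ^ 'n ^ 'n \<Rightarrow> real ^ 'n ^ 'n \<Rightarrow> bool" (infix "\<preceq>" 50) where
  "P \<preceq> Q \<longleftrightarrow> (\<forall>x. 0 \<le> x \<bullet> ((Q - P) *v x))"

definition KL_div :: "(real ^ 'n \<Rightarrow> real) \<Rightarrow> (real ^ 'n \<Rightarrow> real) \<Rightarrow> real" where
  "KL_div f g = (LINT v|torus. f v * ln (f v / g v))"

definition score :: "(real ^ 'n \<Rightarrow> real) \<Rightarrow> real ^ 'n \<Rightarrow> real ^ 'n" where
  "score f = grad (\<lambda>v. ln (f v))"

definition score_velocity :: "(real ^ 'n \<Rightarrow> real ^ 'n ^ 'n) \<Rightarrow> (real ^ 'n \<Rightarrow> real ^ 'n) \<Rightarrow>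
    (real ^ 'n \<Rightarrow> real) \<Rightarrow> real ^ 'n \<Rightarrow> real ^ 'n" where
  "score_velocity A s f v = - (LINT w|torus. f w *\<^sub>R (A (v - w) *v (s v - s w)))"

definition landau_velocity :: "(real ^ 'n \<Rightarrow> real ^ 'n ^ 'n) \<Rightarrow>
    (real ^ 'n \<Rightarrow> real) \<Rightarrow> real ^ 'n \<Rightarrow> real ^ 'n" where
  "landau_velocity A f = score_velocity A (score f) f"

text \<open>
  \<open>\<partial>\<^sub>t f = - \<nabla>\<cdot>(f U)\<close> on \<open>[0,T]\<close>: at each time, for almost every \<open>v\<close> (time derivatives being
  one-sided at \<open>0\<close> and \<open>T\<close>), with the weak divergence of the flux on the right.
\<close>

definition solves_continuity ::
    "real \<Rightarrow> (real \<Rightarrow> real ^ 'n \<Rightarrow> real) \<Rightarrow> (real \<Rightarrow> real ^ 'n \<Rightarrow> real ^ 'n) \<Rightarrow> bool" where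
  "solves_continuity T f U \<longleftrightarrow> (\<forall>t\<in>{0..T}. \<exists>h.
     weak_div (\<lambda>v. f t v *\<^sub>R U t v) h \<and>
     (AE v in torus. ((\<lambda>\<tau>. f \<tau> v) has_real_derivative - h v) (at t within {0..T})))"

definition solves_landau ::
    "real \<Rightarrow> (real ^ 'n \<Rightarrow> real ^ 'n ^ 'n) \<Rightarrow> (real \<Rightarrow> real ^ 'n \<Rightarrow> real) \<Rightarrow> bool" where
  "solves_landau T A f \<longleftrightarrow> solves_continuity T f (\<lambda>t. landau_velocity A (f t))"

definition solves_score_landau :: "real \<Rightarrow> (real ^ 'n \<Rightarrow> real ^ 'n ^ 'n) \<Rightarrow>
    (real \<Rightarrow> real ^ 'n \<Rightarrow> real ^ 'n) \<Rightarrow> (real \<Rightarrow> real ^ 'n \<Rightarrow> real) \<Rightarrow> bool" where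
  "solves_score_landau T A s f \<longleftrightarrow> solves_continuity T f (\<lambda>t. score_velocity A (s t) (f t))"

definition diff_under_integral :: "real \<Rightarrow> (real \<Rightarrow> real ^ 'n \<Rightarrow> real) \<Rightarrow> bool" where
  "diff_under_integral T F \<longleftrightarrow> (\<forall>t\<in>{0..T}. \<exists>F'.
     (AE v in torus. ((\<lambda>\<tau>. F \<tau> v) has_real_derivative F' v) (at t within {0..T})) \<and>
     integrable torus F' \<and>
     ((\<lambda>\<tau>. LINT v|torus. F \<tau> v) has_real_derivative (LINT v|torus. F' v)) (at t within {0..T}))"

end

theory Submission
  imports Defs "HOL-Probability.Probability_Measure"
begin

text \<open>
  Write \<open>g\<close> for the Landau solution at time \<open>t\<close>, \<open>r = \<nabla>log f - \<nabla>log g\<close>, and \<open>A * F\<close> for the convolution on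
  the torus. Testing the two continuity equations with \<open>log (f / g) + 1\<close> and \<open>f / g\<close> gives
  \<open>d/dt KL = \<integral> f r \<bullet> (U\<^sup>\<delta> - U[g])\<close>. Since \<open>f \<nabla>log f = \<nabla>f\<close>, the difference of the velocities is
  \<open>- (A * f) r + (A * f) \<delta> - A * (f \<delta>) - (A * (f - g)) \<nabla>log g + A * \<nabla>(f - g)\<close>.
  The first term dissipates at least \<open>\<lambda>\<^sub>1 |r|\<^sup>2\<close>; the last one equals \<open>(\<nabla>\<cdot>A) * (f - g)\<close>. Young's inequality
  absorbs the other four terms at every point \<open>v\<close>, leaving \<open>\<integral> f |\<delta>|\<^sup>2\<close> and the square of the
  \<open>L\<^sup>1\<close> distance of \<open>f\<close> and \<open>g\<close>, which is at most \<open>2 KL\<close> by Pinsker's inequality.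
\<close>

subsection \<open>Periodic functions and integrals over the torus\<close>

lemma periodic_add_axis:
  assumes "periodic H"
  shows "H (x + of_int k *\<^sub>R axis i 1) = H x"
proof -
  have nat: "H (x + of_nat n *\<^sub>R axis i 1) = H x" for n x
  proof (induction n)
    case (Suc n)
    have "H (x + of_nat n *\<^sub>R axis i 1 + axis i 1) = H (x + of_nat n *\<^sub>R axis i 1)"
      using assms by (simp add: periodic_def)
    with Suc show ?case by (simp add: algebra_simps)
  qed simp
  show ?thesis
  proof (cases k)
    case (nonneg n)
    with nat show ?thesis by simp
  next
    case (neg n)
    \<comment> \<open>Adding \<open>Suc n\<close> forward periods to the shifted point leads back to
      \<open>x\<close>, so the natural case also settles negative shifts.\<close>
    then have "real_of_int k + real (Suc n) = 0" by simp
    then have "x + of_int k *\<^sub>R axis i 1 + of_nat (Suc n) *\<^sub>R axis i 1 = x"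
      by (simp only: add.assoc flip: scaleR_add_left) simp
    with nat[of "x + of_int k *\<^sub>R axis i 1" "Suc n"] show ?thesis by metis
  qed
qed

lemma periodic_add_int:
  fixes H :: "real ^ 'n \<Rightarrow> 'b" and k :: "int ^ 'n"
  assumes "periodic H"
  shows "H (x + (\<chi> i. of_int (k $ i))) = H x"
proof -
  have "H (x + (\<Sum>i\<in>S. of_int (k $ i) *\<^sub>R axis i 1)) = H x" if "finite S" for S
    using that
  proof (induction S)
    case (insert i S)
    then show ?case
      using periodic_add_axis[OF assms, of "x + (\<Sum>i\<in>S. of_int (k $ i) *\<^sub>R axis i 1)" "k $ i" i]
      by (simp add: algebra_simps)
  qed simp
  moreover have "(\<Sum>i\<in>UNIV. of_int (k $ i) *\<^sub>R axis i 1) = ((\<chi> i. of_int (k $ i)) :: real ^ 'n)"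
    by (simp add: vec_eq_iff axis_def if_distrib cong: if_cong)
  ultimately show ?thesis by (metis finite)
qed

text \<open>Half-open, so that the integer translates are disjoint and cover the space; the closed
  cube behind \<open>torus\<close> differs from it by a null set only.\<close>

definition cell :: "(real ^ 'n) set" where
  "cell = {x. \<forall>i. 0 \<le> x $ i \<and> x $ i < 1}"

lemma cell_measurable [measurable]: "cell \<in> sets borel"
  unfolding cell_def by measurable

text \<open>Exactly one translate contains \<open>x\<close>, the one indexed by the vector of floors
  of its coordinates. Writing the sum as an integral for counting measure makes it exchangeable with
  a Lebesgue integral.\<close>

lemma nn_integral_translates_cell:
  "(\<integral>\<^sup>+k. indicator cell (x - (\<chi> i. of_int ((k :: int ^ 'n) $ i))) \<partial>count_space UNIV) = 1"
proof -
  have "(x - (\<chi> i. of_int (k $ i)) \<in> cell) \<longleftrightarrow> k \<in> {\<chi> i. \<lfloor>x $ i\<rfloor>}" for k :: "int ^ 'n"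
  proof -
    have "k $ i = \<lfloor>x $ i\<rfloor> \<longleftrightarrow> 0 \<le> x $ i - of_int (k $ i) \<and> x $ i - of_int (k $ i) < 1" for i
      by linarith
    then show ?thesis by (simp add: cell_def vec_eq_iff)
  qed
  then have "(\<lambda>k. indicator cell (x - (\<chi> i. of_int ((k :: int ^ 'n) $ i))) :: ennreal)
      = indicator {\<chi> i. \<lfloor>x $ i\<rfloor>}"
    by (auto simp: fun_eq_iff indicator_def)
  then show ?thesis by simp
qed

lemma nn_integral_lborel_translate:
  fixes a :: "'a :: euclidean_space"
  assumes [measurable]: "G \<in> borel_measurable borel"
  shows "(\<integral>\<^sup>+x. G (x + a) \<partial>lborel) = (\<integral>\<^sup>+x. G x \<partial>lborel)"
proof -
  have "(\<integral>\<^sup>+x. G x \<partial>lborel) = (\<integral>\<^sup>+x. G x \<partial>distr lborel borel ((+) a))"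
    by (simp add: lborel_distr_plus)
  also have "\<dots> = (\<integral>\<^sup>+x. G (x + a) \<partial>lborel)"
    by (subst nn_integral_distr) (auto simp: add.commute)
  finally show ?thesis ..
qed

lemma nn_integral_lborel_reflect:
  fixes a :: "'a :: euclidean_space"
  assumes [measurable]: "G \<in> borel_measurable borel"
  shows "(\<integral>\<^sup>+x. G (a - x) \<partial>lborel) = (\<integral>\<^sup>+x. G x \<partial>lborel)"
proof -
  have "distr lborel borel uminus = (lborel :: 'a measure)"
    by (subst lborel_affine[of "-1" 0]) (auto simp: density_1 one_ennreal_def[symmetric])
  then have "(\<integral>\<^sup>+x. G (a - x) \<partial>lborel) = (\<integral>\<^sup>+x. G (a - x) \<partial>distr lborel borel uminus)"
    by simp
  also have "\<dots> = (\<integral>\<^sup>+x. G (x + a) \<partial>lborel)"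
    by (subst nn_integral_distr) (auto simp: add.commute)
  finally show ?thesis by (simp add: nn_integral_lborel_translate)
qed

lemma space_torus [simp]: "space torus = cbox 0 1"
  by (simp add: torus_def)

lemma measurable_torus_borel [measurable]: "(\<lambda>x. x) \<in> measurable torus borel"
  unfolding torus_def by (intro measurable_restrict_space1) simp

lemma AE_cbox_iff_cell: "AE x in lborel. x \<in> cbox 0 1 \<longleftrightarrow> (x :: real ^ 'n) \<in> cell"
proof -
  have "emeasure lborel (cbox (0 :: real ^ 'n) 1 - box 0 1) = 0"
    by (subst emeasure_Diff)
      (auto simp: emeasure_lborel_cbox_eq emeasure_lborel_box_eq box_subset_cbox)
  then have "cbox (0 :: real ^ 'n) 1 - box 0 1 \<in> null_sets lborel" by auto
  then have "AE x in lborel. (x :: real ^ 'n) \<notin> cbox 0 1 - box 0 1" by (rule AE_not_in)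
  then show ?thesis
    by eventually_elim (auto simp: cell_def mem_box_cart intro: order.strict_implies_order)
qed

lemma nn_integral_torus:
  assumes "G \<in> borel_measurable borel"
  shows "(\<integral>\<^sup>+x. G x \<partial>torus) = (\<integral>\<^sup>+x. G x * indicator cell x \<partial>lborel)"
proof -
  have "(\<integral>\<^sup>+x. G x \<partial>torus) = (\<integral>\<^sup>+x. G x * indicator (cbox 0 1) x \<partial>lborel)"
    unfolding torus_def by (subst nn_integral_restrict_space) auto
  also have "\<dots> = (\<integral>\<^sup>+x. G x * indicator cell x \<partial>lborel)"
    using AE_cbox_iff_cell by (intro nn_integral_cong_AE) (auto simp: indicator_def)
  finally show ?thesis .
qed

text \<open>Both \<open>cell\<close> and its reflection \<open>v - cell\<close> tile the space under integer translations;
  a periodic function has the same integral over any two such tiles.\<close>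

lemma nn_integral_torus_reflect:
  fixes G :: "real ^ 'n \<Rightarrow> ennreal"
  assumes [measurable]: "G \<in> borel_measurable borel" and per: "periodic G"
  shows "(\<integral>\<^sup>+x. G (v - x) \<partial>torus) = (\<integral>\<^sup>+x. G x \<partial>torus)"
proof -
  define z :: "int ^ 'n \<Rightarrow> real ^ 'n" where "z k = (\<chi> i. of_int (k $ i))" for k
  have tile: "(\<integral>\<^sup>+k. indicator cell (x - z k) \<partial>count_space UNIV) = 1" for x
    unfolding z_def by (rule nn_integral_translates_cell)
  have "(\<integral>\<^sup>+x. G (v - x) \<partial>torus) = (\<integral>\<^sup>+x. G (v - x) * indicator cell x \<partial>lborel)"
    by (rule nn_integral_torus) simp
  also have "\<dots> = (\<integral>\<^sup>+y. G y * indicator cell (v - y) \<partial>lborel)"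
    using nn_integral_lborel_reflect[of "\<lambda>y. G y * indicator cell (v - y)" v] by simp
  \<comment> \<open>Insert the tiling by \<open>cell\<close> as a factor 1, cutting the tile
    \<open>v - cell\<close> into pieces that are then moved by integer vectors.\<close>
  also have "\<dots> = (\<integral>\<^sup>+y. (\<integral>\<^sup>+k. G y * indicator cell (v - y) * indicator cell (y - z k)
      \<partial>count_space UNIV) \<partial>lborel)"
    by (simp add: nn_integral_cmult tile)
  also have "\<dots> = (\<integral>\<^sup>+k. (\<integral>\<^sup>+y. G y * indicator cell (v - y) * indicator cell (y - z k) \<partial>lborel)
      \<partial>count_space UNIV)"
    by (rule nn_integral_count_space_nn_integral) auto
  also have "\<dots> = (\<integral>\<^sup>+k. (\<integral>\<^sup>+y. G (y + z k) * indicator cell (v - (y + z k))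
      * indicator cell (y + z k - z k) \<partial>lborel) \<partial>count_space UNIV)"
    by (intro nn_integral_cong nn_integral_lborel_translate[symmetric]) simp
  \<comment> \<open>Periodicity drops the shift from \<open>G\<close>. The translation index now
    appears only in the factor for the reflected tile, which therefore sums to 1 over
    \<open>k\<close>.\<close>
  also have "\<dots> = (\<integral>\<^sup>+k. (\<integral>\<^sup>+y. G y * indicator cell y * indicator cell ((v - y) - z k) \<partial>lborel)
      \<partial>count_space UNIV)"
    using periodic_add_int[OF per] by (simp add: z_def algebra_simps)
  also have "\<dots> = (\<integral>\<^sup>+y. (\<integral>\<^sup>+k. G y * indicator cell y * indicator cell ((v - y) - z k)
      \<partial>count_space UNIV) \<partial>lborel)"
    by (rule nn_integral_count_space_nn_integral[symmetric]) auto
  also have "\<dots> = (\<integral>\<^sup>+y. G y * indicator cell y \<partial>lborel)"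
    by (simp add: nn_integral_cmult tile)
  also have "\<dots> = (\<integral>\<^sup>+x. G x \<partial>torus)"
    by (simp add: nn_integral_torus)
  finally show ?thesis .
qed

text \<open>Equality of image measures is the common source of two facts: invariance of Bochner
  integrals of vector-valued functions and transfer of almost-everywhere bounds.\<close>

lemma distr_torus_reflect:
  assumes [measurable]: "H \<in> borel_measurable borel" and per: "periodic H"
  shows "distr torus borel (\<lambda>w. H (v - w)) = distr torus borel H"
proof (rule measure_eqI)
  fix B assume "B \<in> sets (distr torus borel (\<lambda>w. H (v - w)))"
  then have [measurable]: "B \<in> sets borel" by simp
  let ?G = "\<lambda>x. indicator B (H x) :: ennreal"
  have "(\<integral>\<^sup>+x. indicator B x \<partial>distr torus borel (\<lambda>w. H (v - w))) = (\<integral>\<^sup>+x. ?G (v - x) \<partial>torus)"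
    by (subst nn_integral_distr) auto
  also have "\<dots> = (\<integral>\<^sup>+x. ?G x \<partial>torus)"
    using per by (intro nn_integral_torus_reflect) (auto simp: periodic_def)
  also have "\<dots> = (\<integral>\<^sup>+x. indicator B x \<partial>distr torus borel H)"
    by (subst nn_integral_distr) auto
  finally show "emeasure (distr torus borel (\<lambda>w. H (v - w))) B = emeasure (distr torus borel H) B"
    by simp
qed simp

lemma
  fixes H :: "real ^ 'n \<Rightarrow> 'b :: {banach, second_countable_topology}"
  assumes [measurable]: "H \<in> borel_measurable borel" and per: "periodic H"
  shows LINT_torus_reflect: "(LINT w|torus. H (v - w)) = (LINT x|torus. H x)"
    and AE_torus_reflect: "Measurable.pred borel P \<Longrightarrow> AE x in torus. P (H x) \<Longrightarrow> AE w in torus. P (H (v - w))"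
proof -
  note eq = distr_torus_reflect[OF assms, of v]
  have "(LINT w|torus. H (v - w)) = (LINT x|distr torus borel (\<lambda>w. H (v - w)). x)"
    by (subst integral_distr) auto
  also have "\<dots> = (LINT x|torus. H x)"
    unfolding eq by (subst integral_distr) auto
  finally show "(LINT w|torus. H (v - w)) = (LINT x|torus. H x)" .
  assume [measurable]: "Measurable.pred borel P" and ae: "AE x in torus. P (H x)"
  have "AE x in distr torus borel H. P x" using ae by (subst AE_distr_iff) auto
  then show "AE w in torus. P (H (v - w))"
    unfolding eq[symmetric] by (subst (asm) AE_distr_iff) auto
qed

interpretation torus: prob_space "torus :: (real ^ 'n) measure"
proof
  have "(1 :: real ^ 'n) \<bullet> b = 1" if "b \<in> Basis" for b
    using that by (auto simp: Basis_vec_def inner_axis)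
  then show "emeasure torus (space (torus :: (real ^ 'n) measure)) = 1"
    by (simp add: torus_def emeasure_restrict_space emeasure_lborel_cbox_eq)
qed

subsection \<open>Pinsker's inequality\<close>

text \<open>The difference is the derivative of \<open>x ln x - x + 1 - 3 (x - 1)\<^sup>2 / (2 x + 4)\<close>, whose minimum at \<open>1\<close>
  is what \<open>entropy_quadratic_bound\<close> below expresses.\<close>

lemma ln_rational_bound_deriv:
  fixes x :: real
  assumes "x > 0"
  shows "((\<lambda>x. ln x - 3 * (x - 1) * (x + 5) / (2 * (x + 2)\<^sup>2)) has_real_derivative
    (x - 1)\<^sup>2 * (x + 8) / (x * (x + 2) ^ 3)) (at x)"
proof -
  have "((\<lambda>x. ln x - 3 * (x - 1) * (x + 5) / (2 * (x + 2)\<^sup>2)) has_real_derivative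
    1 / x - ((3 * (x + 5) + 3 * (x - 1)) * (2 * (x + 2)\<^sup>2) - 3 * (x - 1) * (x + 5) * (4 * (x + 2)))
      / (2 * (x + 2)\<^sup>2)\<^sup>2) (at x)"
    using assms by (auto intro!: derivative_eq_intros simp: power2_eq_square)
  moreover have "1 / x - ((3 * (x + 5) + 3 * (x - 1)) * (2 * (x + 2)\<^sup>2) - 3 * (x - 1) * (x + 5) * (4 * (x + 2)))
      / (2 * (x + 2)\<^sup>2)\<^sup>2 = (x - 1)\<^sup>2 * (x + 8) / (x * (x + 2) ^ 3)"
    using assms by (simp add: divide_simps) algebra
  ultimately show ?thesis by simp
qed

text \<open>The difference of the two sides vanishes at 1 and has the nonnegative derivative just
  computed, so it has the sign of \<open>x - 1\<close>.\<close>

lemma ln_rational_bound: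
  fixes x :: real
  assumes "x > 0"
  shows "1 \<le> x \<Longrightarrow> 3 * (x - 1) * (x + 5) / (2 * (x + 2)\<^sup>2) \<le> ln x"
    and "x \<le> 1 \<Longrightarrow> ln x \<le> 3 * (x - 1) * (x + 5) / (2 * (x + 2)\<^sup>2)"
proof -
  let ?h = "\<lambda>x :: real. ln x - 3 * (x - 1) * (x + 5) / (2 * (x + 2)\<^sup>2)"
  have mono: "?h y \<le> ?h z" if "0 < y" "y \<le> z" for y z
    using \<open>y \<le> z\<close>
  proof (rule DERIV_nonneg_imp_nondecreasing)
    fix x assume "y \<le> x" "x \<le> z"
    with that show "\<exists>D. (?h has_real_derivative D) (at x) \<and> 0 \<le> D"
      by (intro exI[of _ "(x - 1)\<^sup>2 * (x + 8) / (x * (x + 2) ^ 3)"] conjI ln_rational_bound_deriv) auto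
  qed
  from mono[of 1 x] show "1 \<le> x \<Longrightarrow> 3 * (x - 1) * (x + 5) / (2 * (x + 2)\<^sup>2) \<le> ln x"
    by simp
  from mono[of x 1] assms show "x \<le> 1 \<Longrightarrow> ln x \<le> 3 * (x - 1) * (x + 5) / (2 * (x + 2)\<^sup>2)"
    by simp
qed

lemma entropy_quadratic_bound:
  fixes x :: real
  assumes "x > 0"
  shows "3 * (x - 1)\<^sup>2 \<le> (2 * x + 4) * (x * ln x - x + 1)"
proof -
  let ?h = "\<lambda>x :: real. x * ln x - x + 1 - 3 * (x - 1)\<^sup>2 / (2 * x + 4)"
  let ?h' = "\<lambda>x :: real. ln x - 3 * (x - 1) * (x + 5) / (2 * (x + 2)\<^sup>2)"
  have deriv: "(?h has_real_derivative ?h' x) (at x)" if "x > 0" for x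
  proof -
    have "(?h has_real_derivative
        ln x + 1 - 1 - (6 * (x - 1) * (2 * x + 4) - 3 * (x - 1)\<^sup>2 * 2) / (2 * x + 4)\<^sup>2) (at x)"
      using that by (auto intro!: derivative_eq_intros simp: power2_eq_square)
    moreover have "(6 * (x - 1) * (2 * x + 4) - 3 * (x - 1)\<^sup>2 * 2) / (2 * x + 4)\<^sup>2
        = 3 * (x - 1) * (x + 5) / (2 * (x + 2)\<^sup>2)"
      using that by (simp add: divide_simps) algebra
    ultimately show ?thesis by simp
  qed
  \<comment> \<open>\<open>?h\<close> vanishes at 1, and by the preceding bounds its derivative has
    the sign of \<open>x - 1\<close>; multiplying by \<open>2 * x + 4\<close> then gives the
    claim.\<close>
  have "?h 1 \<le> ?h x"
  proof (cases "1 \<le> x")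
    case True
    then show ?thesis
    proof (rule DERIV_nonneg_imp_nondecreasing)
      fix y :: real assume "1 \<le> y" "y \<le> x"
      with deriv[of y] ln_rational_bound(1)[of y]
      show "\<exists>D. (?h has_real_derivative D) (at y) \<and> 0 \<le> D"
        by (intro exI[of _ "?h' y"]) auto
    qed
  next
    case False
    then have "x \<le> 1" by simp
    then show ?thesis
    proof (rule DERIV_nonpos_imp_nonincreasing)
      fix y :: real assume "x \<le> y" "y \<le> 1"
      with assms deriv[of y] ln_rational_bound(2)[of y]
      show "\<exists>D. (?h has_real_derivative D) (at y) \<and> D \<le> 0"
        by (intro exI[of _ "?h' y"]) auto
    qed
  qed
  with assms show ?thesis by (simp add: field_simps)
qed

text \<open>Both sides are homogeneous of degree 2 in \<open>(p, q)\<close>: take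
  \<open>x = p / q\<close> and multiply by the square of \<open>q\<close>.\<close>

lemma entropy_quadratic_bound_ratio:
  fixes p q :: real
  assumes "p > 0" "q > 0"
  shows "3 * (p - q)\<^sup>2 \<le> (2 * p + 4 * q) * (p * ln (p / q) - p + q)"
proof -
  have "q\<^sup>2 * (3 * (p / q - 1)\<^sup>2) \<le> q\<^sup>2 * ((2 * (p / q) + 4) * (p / q * ln (p / q) - p / q + 1))"
    using assms by (intro mult_left_mono entropy_quadratic_bound) auto
  also have "q\<^sup>2 * (3 * (p / q - 1)\<^sup>2) = 3 * (p - q)\<^sup>2"
    using assms by (simp add: field_simps power2_eq_square)
  also have "q\<^sup>2 * ((2 * (p / q) + 4) * (p / q * ln (p / q) - p / q + 1))
      = (2 * p + 4 * q) * (p * ln (p / q) - p + q)"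
    using assms by (simp add: field_simps power2_eq_square)
  finally show ?thesis .
qed

text \<open>Pointwise, \<open>p - q\<close> is at most the geometric mean of
  \<open>Q = (2 p + 4 q) / 3\<close>, of integral 2, and \<open>P = p ln (p / q) - p + q\<close>, of
  integral \<open>KL\<close>. Young's inequality with a free parameter \<open>\<theta>\<close>
  replaces Cauchy-Schwarz for integrals; \<open>\<theta>\<close> is chosen after
  integration.\<close>

lemma pinsker_inequality:
  fixes p q :: "'a \<Rightarrow> real"
  assumes pos: "\<And>x. p x > 0" "\<And>x. q x > 0"
    and int [simp]: "integrable M p" "integrable M q" "integrable M (\<lambda>x. p x * ln (p x / q x))"
    and mass: "integral\<^sup>L M p = 1" "integral\<^sup>L M q = 1"
  shows "(LINT x|M. \<bar>p x - q x\<bar>)\<^sup>2 \<le> 2 * (LINT x|M. p x * ln (p x / q x))"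
proof -
  define N where "N = (LINT x|M. \<bar>p x - q x\<bar>)"
  define KL where "KL = (LINT x|M. p x * ln (p x / q x))"
  have pt: "\<bar>p x - q x\<bar> \<le> \<theta> * ((2 * p x + 4 * q x) / 3) / 2 + (p x * ln (p x / q x) - p x + q x) / (2 * \<theta>)"
    if "\<theta> > 0" for x \<theta>
  proof -
    define Q where "Q = (2 * p x + 4 * q x) / 3"
    define P where "P = p x * ln (p x / q x) - p x + q x"
    have Q: "Q > 0" using pos[of x] by (simp add: Q_def)
    have QP: "(p x - q x)\<^sup>2 \<le> Q * P"
      using entropy_quadratic_bound_ratio[OF pos, of x x] by (simp add: Q_def P_def)
    have "0 \<le> (p x - q x)\<^sup>2" by simp
    with QP have "0 \<le> Q * P" by linarith
    with Q have P: "P \<ge> 0" by (simp add: zero_le_mult_iff)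
    \<comment> \<open>The inequality of arithmetic and geometric means for
      \<open>\<theta> * Q\<close> and \<open>P / \<theta>\<close>, written as an identity with a
      square remainder.\<close>
    have "(\<theta> * Q / 2 + P / (2 * \<theta>))\<^sup>2 = Q * P + (\<theta> * Q / 2 - P / (2 * \<theta>))\<^sup>2"
      using that by (simp add: field_simps power2_eq_square)
    with QP have "\<bar>p x - q x\<bar>\<^sup>2 \<le> (\<theta> * Q / 2 + P / (2 * \<theta>))\<^sup>2"
      by (simp add: add_increasing2)
    then show ?thesis
      unfolding Q_def[symmetric] P_def[symmetric]
      by (rule power2_le_imp_le) (use that P Q in auto)
  qed
  have bound: "N \<le> \<theta> + KL / (2 * \<theta>)" if "\<theta> > 0" for \<theta>
  proof -
    have "N \<le> (LINT x|M. \<theta> * ((2 * p x + 4 * q x) / 3) / 2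
        + (p x * ln (p x / q x) - p x + q x) / (2 * \<theta>))"
      unfolding N_def by (intro integral_mono pt that) auto
    also have "\<dots> = \<theta> + KL / (2 * \<theta>)"
      by (simp add: mass KL_def)
    finally show ?thesis .
  qed
  have "N\<^sup>2 \<le> 2 * KL"
  proof (cases "N = 0")
    case True
    have "KL \<ge> 0"
    proof (rule ccontr)
      assume "\<not> KL \<ge> 0"
      \<comment> \<open>If \<open>KL\<close> were negative, this \<open>\<theta>\<close> would make
        the upper bound for \<open>N = 0\<close> equal to \<open>- sqrt (- KL) / 2\<close>, which is
        negative.\<close>
      then show False using bound[of "sqrt (- KL) / 2"] True
        by (simp add: field_simps flip: power2_eq_square)
    qed
    with True show ?thesis by simp
  next
    case False
    then have N: "N > 0" by (simp add: N_def less_le)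
    \<comment> \<open>The choice \<open>\<theta> = N / 2\<close> yields the sharp constant without
      knowing beforehand that \<open>KL\<close> is nonnegative.\<close>
    then have "N \<le> N / 2 + KL / N" using bound[of "N / 2"] by simp
    with N show ?thesis by (simp add: field_simps power2_eq_square)
  qed
  then show ?thesis by (simp add: N_def KL_def)
qed

subsection \<open>Essential bounds on matrix-valued functions\<close>

lemma norm_le_sqrt_card:
  fixes y :: "real ^ 'n"
  assumes "\<And>i. \<bar>y $ i\<bar> \<le> c"
  shows "norm y \<le> sqrt (CARD('n)) * c"
proof -
  have "0 \<le> c" using assms[of undefined] by simp
  have "(\<Sum>i\<in>UNIV. (norm (y $ i))\<^sup>2) \<le> (\<Sum>i\<in>(UNIV :: 'n set). c\<^sup>2)"
    using assms by (intro sum_mono power_mono) auto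
  then have "norm y \<le> sqrt (CARD('n) * c\<^sup>2)"
    by (simp add: norm_vec_def L2_set_def)
  with \<open>0 \<le> c\<close> show ?thesis by (simp add: real_sqrt_mult)
qed

text \<open>One factor \<open>sqrt d\<close> comes from the Euclidean norm of a row, the other from
  collecting the \<open>d\<close> components. Squared, this is the origin of the
  \<open>d\<close>-squared terms in the final constants.\<close>

lemma norm_matrix_vector_mult_le:
  fixes K :: "real ^ 'n ^ 'n" and a :: real
  assumes "\<And>i j. \<bar>K $ i $ j\<bar> \<le> a"
  shows "norm (K *v x) \<le> CARD('n) * a * norm x"
proof -
  have "\<bar>(K *v x) $ i\<bar> \<le> sqrt (CARD('n)) * a * norm x" for i
  proof -
    have "\<bar>(K *v x) $ i\<bar> \<le> norm (K $ i) * norm x"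
      by (simp add: matrix_vector_mul_component Cauchy_Schwarz_ineq2)
    also have "\<dots> \<le> sqrt (CARD('n)) * a * norm x"
      using assms by (intro mult_right_mono norm_le_sqrt_card) auto
    finally show ?thesis .
  qed
  then have "norm (K *v x) \<le> sqrt (CARD('n)) * (sqrt (CARD('n)) * a * norm x)"
    by (rule norm_le_sqrt_card)
  then show ?thesis by (simp add: algebra_simps)
qed

text \<open>The essential supremum must be shown finite, since \<open>real_of_ereal\<close> sends
  infinite values to 0. It is bounded above by hypothesis, and below by 0 because the torus has
  positive measure.\<close>

lemma AE_le_Linf_norm:
  fixes h :: "real ^ 'n \<Rightarrow> real"
  assumes "Linf_torus h"
  shows "AE x in torus. \<bar>h x\<bar> \<le> Linf_norm h"
proof -
  obtain K where [measurable]: "h \<in> borel_measurable borel" and K: "AE x in torus. \<bar>h x\<bar> \<le> K"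
    using assms by (auto simp: Linf_torus_def Linf_le_def)
  let ?e = "esssup torus (\<lambda>x. ereal \<bar>h x\<bar>)"
  have "?e \<le> ereal K" using K by (intro esssup_I) auto
  moreover have "0 \<le> ?e"
  proof -
    have "0 = esssup (torus :: (real ^ 'n) measure) (\<lambda>x. 0 :: ereal)"
      by (simp only: esssup_const torus.emeasure_space_1 one_neq_zero not_False_eq_True)
    also have "\<dots> \<le> ?e" by (rule esssup_mono) auto
    finally show ?thesis .
  qed
  ultimately have e: "?e = ereal (Linf_norm h)"
    by (cases ?e) (auto simp: Linf_norm_def)
  show "AE x in torus. \<bar>h x\<bar> \<le> Linf_norm h"
    using esssup_AE[of "\<lambda>x. ereal \<bar>h x\<bar>" torus] unfolding e by simp
qed

lemma AE_le_mat_Linf_norm: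
  fixes A :: "real ^ 'n \<Rightarrow> real ^ 'n ^ 'n"
  assumes "\<And>i j. Linf_torus (\<lambda>x. A x $ i $ j)"
  shows "AE x in torus. \<forall>i j. \<bar>A x $ i $ j\<bar> \<le> mat_Linf_norm A"
proof -
  have le: "Linf_norm (\<lambda>x. A x $ i $ j) \<le> mat_Linf_norm A" for i j
    unfolding mat_Linf_norm_def by (intro Max_ge) (auto intro: rev_image_eqI[of "(i, j)"])
  have "AE x in torus. \<forall>i\<in>UNIV. \<forall>j\<in>UNIV. \<bar>A x $ i $ j\<bar> \<le> Linf_norm (\<lambda>x. A x $ i $ j)"
    by (intro AE_finite_allI finite AE_le_Linf_norm assms)
  then show ?thesis
    by eventually_elim (auto intro: order_trans[OF _ le])
qed

lemma AE_le_vec_Linf_norm: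
  fixes F :: "real ^ 'n \<Rightarrow> real ^ 'n"
  assumes "\<And>i. Linf_torus (\<lambda>x. F x $ i)"
  shows "AE x in torus. \<forall>i. \<bar>F x $ i\<bar> \<le> vec_Linf_norm F"
proof -
  have le: "Linf_norm (\<lambda>x. F x $ i) \<le> vec_Linf_norm F" for i
    unfolding vec_Linf_norm_def by (intro Max_ge) auto
  have "AE x in torus. \<forall>i\<in>UNIV. \<bar>F x $ i\<bar> \<le> Linf_norm (\<lambda>x. F x $ i)"
    by (intro AE_finite_allI finite AE_le_Linf_norm assms)
  then show ?thesis
    by eventually_elim (auto intro: order_trans[OF _ le])
qed

subsection \<open>Gradients of periodic functions\<close>

lemma grad_eqI:
  assumes "(f has_derivative (\<lambda>h. G \<bullet> h)) (at x)"
  shows "grad f x = G"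
proof -
  have "frechet_derivative f (at x) = (\<lambda>h. G \<bullet> h)"
    using frechet_derivative_at[OF assms] ..
  then show ?thesis by (simp add: grad_def vec_eq_iff inner_axis)
qed

lemma has_derivative_grad:
  fixes f :: "real ^ 'n \<Rightarrow> real"
  assumes "f differentiable at x"
  shows "(f has_derivative (\<lambda>h. grad f x \<bullet> h)) (at x)"
proof -
  let ?D = "frechet_derivative f (at x)"
  interpret D: linear ?D using assms by (rule linear_frechet_derivative)
  have "?D h = grad f x \<bullet> h" for h
  proof -
    have "?D h = ?D (\<Sum>i\<in>UNIV. h $ i *\<^sub>R axis i 1)"
      using basis_expansion[of h] by (simp add: scalar_mult_eq_scaleR)
    also have "\<dots> = grad f x \<bullet> h"
      by (simp add: D.sum D.scaleR grad_def inner_vec_def mult.commute)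
    finally show ?thesis .
  qed
  then have "?D = (\<lambda>h. grad f x \<bullet> h)" by auto
  with assms show ?thesis using frechet_derivative_works[of f "at x"] by simp
qed

lemma C1_torusI:
  assumes "periodic f" and "\<And>x. (f has_derivative (\<lambda>h. G x \<bullet> h)) (at x)" and "continuous_on UNIV G"
  shows "C1_torus f" and "grad f = G"
proof -
  show "grad f = G" using assms(2) by (auto intro: grad_eqI)
  with assms show "C1_torus f" by (auto simp: C1_torus_def differentiable_def)
qed

lemma C1_torusD:
  assumes "C1_torus f"
  shows "periodic f" and "(f has_derivative (\<lambda>h. grad f x \<bullet> h)) (at x)"
    and "continuous_on UNIV (grad f)" and "continuous_on UNIV f"
  using assms
  by (auto simp: C1_torus_def intro!: has_derivative_grad continuous_at_imp_continuous_on
      dest: differentiable_imp_continuous_within)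

text \<open>Differentiate the periodicity identity and use uniqueness of the derivative. Periodicity
  of the gradient is required when an integrand containing it is reflected on the torus.\<close>

lemma periodic_grad:
  fixes f :: "real ^ 'n \<Rightarrow> real"
  assumes "C1_torus f"
  shows "periodic (grad f)"
  unfolding periodic_def
proof (intro allI)
  fix x :: "real ^ 'n" and i
  have "((\<lambda>x. x + axis i 1) has_derivative (\<lambda>h. h)) (at x)"
    by (auto intro!: derivative_eq_intros)
  from has_derivative_compose[OF this C1_torusD(2)[OF assms]]
  have "(f has_derivative (\<lambda>h. grad f (x + axis i 1) \<bullet> h)) (at x)"
    using C1_torusD(1)[OF assms] by (simp add: periodic_def)
  then show "grad f (x + axis i 1) = grad f x" by (rule grad_eqI[symmetric])
qed

lemma
  assumes f: "C1_torus f" and pos: "\<And>x. f x > 0"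
  shows C1_torus_ln: "C1_torus (\<lambda>x. ln (f x))"
    and score_eq: "score f x = grad f x /\<^sub>R f x"
proof -
  have *: "((\<lambda>x. ln (f x)) has_derivative (\<lambda>h. (grad f x /\<^sub>R f x) \<bullet> h)) (at x)" for x
    by (rule derivative_eq_intros C1_torusD(2)[OF f] pos refl)+
      (auto simp: fun_eq_iff divide_inverse mult.commute)
  have c: "continuous_on UNIV (\<lambda>x. grad f x /\<^sub>R f x)"
    using pos by (intro continuous_intros C1_torusD[OF f]) (auto simp: less_imp_neq[symmetric])
  have p: "periodic (\<lambda>x. ln (f x))"
    using C1_torusD(1)[OF f] by (simp add: periodic_def)
  show "C1_torus (\<lambda>x. ln (f x))" by (rule C1_torusI[OF p * c])
  show "score f x = grad f x /\<^sub>R f x" using C1_torusI(2)[OF p * c] by (simp add: score_def)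
qed

lemma
  assumes f: "C1_torus f" and g: "C1_torus g"
  shows C1_torus_diff: "C1_torus (\<lambda>x. f x - g x)"
    and grad_diff: "grad (\<lambda>x. f x - g x) x = grad f x - grad g x"
proof -
  have *: "((\<lambda>x. f x - g x) has_derivative (\<lambda>h. (grad f x - grad g x) \<bullet> h)) (at x)" for x
    by (rule derivative_eq_intros C1_torusD(2)[OF f] C1_torusD(2)[OF g] refl)+
      (auto simp: inner_diff_left)
  have c: "continuous_on UNIV (\<lambda>x. grad f x - grad g x)"
    by (intro continuous_intros C1_torusD f g)
  have p: "periodic (\<lambda>x. f x - g x)"
    using C1_torusD(1)[OF f] C1_torusD(1)[OF g] by (simp add: periodic_def)
  show "C1_torus (\<lambda>x. f x - g x)" by (rule C1_torusI[OF p * c])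
  show "grad (\<lambda>x. f x - g x) x = grad f x - grad g x" using C1_torusI(2)[OF p * c] by simp
qed

text \<open>Reflected functions are the test functions that move a derivative from a density onto
  the kernel inside a convolution; the chain rule supplies the sign.\<close>

lemma
  assumes f: "C1_torus f"
  shows C1_torus_reflect: "C1_torus (\<lambda>x. f (v - x))"
    and grad_reflect: "grad (\<lambda>x. f (v - x)) x = - grad f (v - x)"
proof -
  have *: "((\<lambda>x. f (v - x)) has_derivative (\<lambda>h. (- grad f (v - x)) \<bullet> h)) (at x)" for x
  proof -
    have "((\<lambda>x. v - x) has_derivative (\<lambda>h. - h)) (at x)"
      by (auto intro!: derivative_eq_intros)
    from has_derivative_compose[OF this C1_torusD(2)[OF f]] show ?thesis by simp
  qed
  have c: "continuous_on UNIV (\<lambda>x. - grad f (v - x))"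
    by (intro continuous_intros continuous_on_compose2[OF C1_torusD(3)[OF f]]) auto
  have p: "periodic (\<lambda>x. f (v - x))"
    unfolding periodic_def
  proof (intro allI)
    fix x i
    have "f (v - (x + axis i 1) + axis i 1) = f (v - (x + axis i 1))"
      using C1_torusD(1)[OF f] unfolding periodic_def by blast
    then show "f (v - (x + axis i 1)) = f (v - x)" by (simp add: algebra_simps)
  qed
  show "C1_torus (\<lambda>x. f (v - x))" by (rule C1_torusI[OF p * c])
  show "grad (\<lambda>x. f (v - x)) x = - grad f (v - x)" using C1_torusI(2)[OF p * c] by simp
qed

text \<open>\<open>ln (p / q) + 1\<close> and \<open>- p / q\<close> are the partial derivatives of
  \<open>p * ln (p / q)\<close> in \<open>p\<close> and \<open>q\<close>, whence these two test
  functions. Both are smooth functions of \<open>ln f - ln g\<close>, so one gradient serves for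
  both.\<close>

lemma
  assumes f: "C1_torus f" and g: "C1_torus g" and pos: "\<And>x. f x > 0" "\<And>x. g x > 0"
  shows C1_torus_log_ratio: "C1_torus (\<lambda>x. ln (f x / g x) + 1)"
    and grad_log_ratio: "grad (\<lambda>x. ln (f x / g x) + 1) x = score f x - score g x"
    and C1_torus_ratio: "C1_torus (\<lambda>x. f x / g x)"
    and grad_ratio: "grad (\<lambda>x. f x / g x) x = (f x / g x) *\<^sub>R (score f x - score g x)"
proof -
  let ?l = "\<lambda>x. ln (f x) - ln (g x)"
  note l = C1_torus_diff[OF C1_torus_ln[OF f pos(1)] C1_torus_ln[OF g pos(2)]]
  have grad_l: "grad ?l x = score f x - score g x" for x
    unfolding score_def by (rule grad_diff) (intro C1_torus_ln f g pos)+
  have ratio: "ln (f x / g x) = ?l x" "f x / g x = exp (?l x)" for x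
    using pos by (simp_all add: ln_div exp_diff less_imp_neq[symmetric])
  have 1: "((\<lambda>x. ?l x + 1) has_derivative (\<lambda>h. grad ?l x \<bullet> h)) (at x)" for x
    using has_derivative_add[OF C1_torusD(2)[OF l, of x] has_derivative_const] by simp
  have 2: "((\<lambda>x. exp (?l x)) has_derivative (\<lambda>h. (exp (?l x) *\<^sub>R grad ?l x) \<bullet> h)) (at x)" for x
    by (rule has_derivative_exp[OF C1_torusD(2)[OF l, of x], THEN has_derivative_eq_rhs])
      (simp add: fun_eq_iff)
  have c: "continuous_on UNIV (\<lambda>x. exp (?l x) *\<^sub>R grad ?l x)"
    using C1_torusD(3,4)[OF l] by (intro continuous_on_scaleR continuous_on_exp) auto
  have p: "periodic (\<lambda>x. ?l x + 1)" "periodic (\<lambda>x. exp (?l x))"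
    using C1_torusD(1)[OF f] C1_torusD(1)[OF g] by (simp_all add: periodic_def)
  note r1 = C1_torusI[OF p(1) 1 C1_torusD(3)[OF l]] and r2 = C1_torusI[OF p(2) 2 c]
  show "C1_torus (\<lambda>x. ln (f x / g x) + 1)" using r1 by (simp only: ratio(1))
  show "grad (\<lambda>x. ln (f x / g x) + 1) x = score f x - score g x"
    using r1(2) grad_l by (simp only: ratio(1))
  show "C1_torus (\<lambda>x. f x / g x)" using r2 by (simp only: ratio(2))
  have "grad (\<lambda>x. f x / g x) x = exp (?l x) *\<^sub>R grad ?l x" 
    using r2(2) by (simp only: ratio(2))
  then show "grad (\<lambda>x. f x / g x) x = (f x / g x) *\<^sub>R (score f x - score g x)"
    by (simp only: grad_l ratio(2))
qed

section \<open>Integrability of products with continuous functions on the compact cube\<close>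

lemma continuous_bounded_on_cube:
  fixes h :: "real ^ 'n \<Rightarrow> 'b :: real_normed_vector"
  assumes "continuous_on UNIV h"
  obtains B where "B \<ge> 0" "\<And>x. x \<in> cbox 0 1 \<Longrightarrow> norm (h x) \<le> B"
proof -
  have "compact (h ` cbox 0 1)"
    using assms by (intro compact_continuous_image) (auto intro: continuous_on_subset)
  then obtain B where "\<forall>y\<in>h ` cbox 0 1. norm y \<le> B"
    using compact_imp_bounded bounded_iff by metis
  then show thesis by (intro that[of "max B 0"]) (auto simp: le_max_iff_disj)
qed

lemma integrable_torus_bounded_scaleR:
  fixes F :: "real ^ 'n \<Rightarrow> 'b :: {banach, second_countable_topology}"
  assumes "continuous_on UNIV u" and F: "integrable torus F"
  shows "integrable torus (\<lambda>x. u x *\<^sub>R F x)"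
proof -
  obtain B where B: "B \<ge> 0" "\<And>x. x \<in> cbox 0 1 \<Longrightarrow> norm (u x) \<le> B"
    using continuous_bounded_on_cube[OF assms(1)] by blast
  have [measurable]: "u \<in> borel_measurable borel" "F \<in> borel_measurable torus"
    using assms by (auto intro: borel_measurable_continuous_onI)
  show ?thesis
  proof (rule Bochner_Integration.integrable_bound)
    show "integrable torus (\<lambda>x. B *\<^sub>R F x)" using F by simp
    show "AE x in torus. norm (u x *\<^sub>R F x) \<le> norm (B *\<^sub>R F x)"
      using B by (intro AE_I2) (auto intro!: mult_right_mono)
  qed measurable
qed

lemma integrable_torus_continuous:
  fixes u :: "real ^ 'n \<Rightarrow> 'b :: {banach, second_countable_topology}"
  assumes "continuous_on UNIV u"
  shows "integrable torus u"
proof -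
  obtain B where B: "B \<ge> 0" "\<And>x. x \<in> cbox 0 1 \<Longrightarrow> norm (u x) \<le> B"
    using continuous_bounded_on_cube[OF assms(1)] by blast
  have [measurable]: "u \<in> borel_measurable borel"
    using assms by (auto intro: borel_measurable_continuous_onI)
  show ?thesis
    by (rule torus.integrable_const_bound[of _ B]) (use B in auto)
qed

lemma integrable_torus_inner_continuous:
  fixes F :: "real ^ 'n \<Rightarrow> real ^ 'n"
  assumes "continuous_on UNIV u" and F: "integrable torus F"
  shows "integrable torus (\<lambda>x. F x \<bullet> u x)"
proof -
  obtain B where B: "B \<ge> 0" "\<And>x. x \<in> cbox 0 1 \<Longrightarrow> norm (u x) \<le> B"
    using continuous_bounded_on_cube[OF assms(1)] by blast
  have [measurable]: "u \<in> borel_measurable borel" "F \<in> borel_measurable torus"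
    using assms by (auto intro: borel_measurable_continuous_onI)
  show ?thesis
  proof (rule Bochner_Integration.integrable_bound)
    show "integrable torus (\<lambda>x. B *\<^sub>R F x)" using F by simp
    show "AE x in torus. norm (F x \<bullet> u x) \<le> norm (B *\<^sub>R F x)"
    proof (intro AE_I2)
      fix x :: "real ^ 'n" assume "x \<in> space torus"
      have "norm (F x \<bullet> u x) \<le> norm (F x) * norm (u x)"
        by (simp add: Cauchy_Schwarz_ineq2)
      also have "\<dots> \<le> norm (F x) * B"
        using B \<open>x \<in> space torus\<close> by (intro mult_left_mono) auto
      finally show "norm (F x \<bullet> u x) \<le> norm (B *\<^sub>R F x)"
        using B by (simp add: mult.commute)
    qed
  qed measurable
qed

subsection \<open>Entropy dissipation at a fixed time\<close>

lemma L2_torus_integrable: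
  fixes F :: "real ^ 'n \<Rightarrow> 'b :: {banach, second_countable_topology}"
  assumes "L2_torus F"
  shows "integrable torus F"
proof (rule Bochner_Integration.integrable_bound)
  show "integrable torus (\<lambda>x. 1 + (norm (F x))\<^sup>2)"
    using assms by (simp add: L2_torus_def)
  have [measurable]: "F \<in> borel_measurable borel"
    using assms by (simp add: L2_torus_def)
  show "F \<in> borel_measurable torus" by measurable
  show "AE x in torus. norm (F x) \<le> norm (1 + (norm (F x))\<^sup>2)"
  proof (intro AE_I2)
    fix x
    \<comment> \<open>This square gives the bound of \<open>norm (F x)\<close> by its square plus
      1/4.\<close>
    have "0 \<le> (norm (F x) - 1 / 2)\<^sup>2" by simp
    then show "norm (F x) \<le> norm (1 + (norm (F x))\<^sup>2)"
      by (simp add: power2_eq_square algebra_simps)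
  qed
qed

text \<open>The dissipation \<open>lam * R\<^sup>2\<close> is divided into four equal parts, one for
  each product; a quarter of it costs exactly \<open>V\<^sup>2 / lam\<close>.\<close>

lemma young_absorb:
  fixes R lam X Y Z W :: real
  assumes "lam > 0"
  shows "R * X + R * Y + R * Z + R * W - lam * R\<^sup>2 \<le> (X\<^sup>2 + Y\<^sup>2 + Z\<^sup>2 + W\<^sup>2) / lam"
proof -
  have "R * V \<le> lam / 4 * R\<^sup>2 + V\<^sup>2 / lam" for V
  proof -
    have "0 \<le> (lam * R / 2 - V)\<^sup>2 / lam" using assms by simp
    also have "\<dots> = lam / 4 * R\<^sup>2 + V\<^sup>2 / lam - R * V"
      using assms by (simp add: field_simps power2_eq_square)
    finally show ?thesis by simp
  qed
  from this[of X] this[of Y] this[of Z] this[of W] show ?thesis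
    by (simp add: add_divide_distrib)
qed

lemma borel_measurable_vec_nth_euclidean [measurable]:
  "(\<lambda>x :: 'a :: euclidean_space ^ 'n. x $ i) \<in> borel_measurable borel"
  by (intro borel_measurable_continuous_onI continuous_intros)

text \<open>The row-wise weak divergence gives measurability of \<open>A\<close> one row at a time;
  the matrix-valued integrals call for it jointly.\<close>

lemma measurable_matrix_rows:
  fixes A :: "real ^ 'n \<Rightarrow> real ^ 'n ^ 'n"
  assumes "\<And>i. (\<lambda>x. row i (A x)) \<in> borel_measurable M"
  shows "A \<in> borel_measurable M"
  unfolding borel_measurable_euclidean_space[of A]
proof
  fix b :: "real ^ 'n ^ 'n" assume "b \<in> Basis"
  then obtain i u where b: "b = axis i u" by (auto simp: Basis_vec_def)
  have "(\<lambda>x. row i (A x) \<bullet> u) \<in> borel_measurable M"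
    using assms[of i] by measurable
  then show "(\<lambda>x. A x \<bullet> b) \<in> borel_measurable M"
    by (simp add: b inner_axis row_def vec_nth_inverse)
qed

lemma measurable_matrix_vector_mult:
  fixes K :: "'a \<Rightarrow> real ^ 'n ^ 'm" and y :: "'a \<Rightarrow> real ^ 'n"
  assumes "K \<in> borel_measurable M" "y \<in> borel_measurable M"
  shows "(\<lambda>x. K x *v y x) \<in> borel_measurable M"
  using assms
  by (rule borel_measurable_continuous_Pair)
    (auto simp: matrix_vector_mult_def intro!: continuous_intros)

text \<open>Time is frozen: \<open>f\<close> and \<open>g\<close> are the score-based and the Landau
  solution at one instant. The numbers \<open>a\<close> and \<open>b\<close> stand for the essential
  bounds of the kernel and of its divergence.\<close>

locale landau_slice =
  fixes A :: "real ^ 'n \<Rightarrow> real ^ 'n ^ 'n" and divA :: "real ^ 'n \<Rightarrow> real ^ 'n"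
    and a b lam M :: real
    and f g :: "real ^ 'n \<Rightarrow> real" and s :: "real ^ 'n \<Rightarrow> real ^ 'n"
  assumes A_le: "AE x in torus. \<forall>i j. \<bar>A x $ i $ j\<bar> \<le> a"
    and divA: "weak_div_rows A divA"
    and divA_le: "AE x in torus. \<forall>i. \<bar>divA x $ i\<bar> \<le> b"
    and lam: "lam > 0" and elliptic: "lam * (norm x)\<^sup>2 \<le> x \<bullet> (A z *v x)"
    and f: "C1_torus f" and g: "C1_torus g"
    and pos: "\<And>x. f x > 0" "\<And>x. g x > 0"
    and mass: "(LINT x|torus. f x) = 1" "(LINT x|torus. g x) = 1"
    and s: "L2_torus s"
    and score_le: "norm (score g x) \<le> M"
begin

text \<open>The density is part of \<open>y\<close>, so terms weighted by \<open>f\<close>, by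
  \<open>f - g\<close> and bare gradients are all values of one linear operator.\<close>

definition conv :: "(real ^ 'n \<Rightarrow> real ^ 'n) \<Rightarrow> real ^ 'n \<Rightarrow> real ^ 'n" where
  "conv y v = (LINT w|torus. A (v - w) *v y w)"

definition err :: "real ^ 'n \<Rightarrow> real ^ 'n" where
  "err v = score f v - s v"

definition N :: real where "N = (LINT w|torus. \<bar>f w - g w\<bar>)"

definition E :: real where "E = (LINT v|torus. f v * (norm (err v))\<^sup>2)"

lemma a_nonneg: "a \<ge> 0"
proof -
  have "AE x in (torus :: (real ^ 'n) measure). 0 \<le> a"
    using A_le by eventually_elim (meson abs_ge_zero order_trans)
  then show ?thesis by simp
qed

lemma continuous:
  shows "continuous_on UNIV f" "continuous_on UNIV g"
    "continuous_on UNIV (grad f)" "continuous_on UNIV (grad g)"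
    "continuous_on UNIV (score f)" "continuous_on UNIV (score g)"
  using C1_torusD(3,4)[OF f] C1_torusD(3,4)[OF g]
    C1_torusD(3)[OF C1_torus_ln[OF f pos(1)]] C1_torusD(3)[OF C1_torus_ln[OF g pos(2)]]
  by (simp_all add: score_def)

text \<open>The logarithmic derivative turns a score weighted by its own density into a gradient,
  which can then be moved onto \<open>A\<close>.\<close>

lemma grad_eq: "grad f x = f x *\<^sub>R score f x" "grad g x = g x *\<^sub>R score g x"
  using pos by (simp_all add: score_eq[OF f pos(1)] score_eq[OF g pos(2)] less_imp_neq[symmetric])

lemma s_integrable: "integrable torus s"
  using s by (rule L2_torus_integrable)

lemma measurable_coeffs [measurable]:
  shows "A \<in> borel_measurable borel" "divA \<in> borel_measurable borel" "s \<in> borel_measurable borel"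
    "f \<in> borel_measurable borel" "g \<in> borel_measurable borel"
    "score f \<in> borel_measurable borel" "score g \<in> borel_measurable borel"
proof -
  have rows: "L1_torus (\<lambda>x. row i (A x))" "L1_torus (\<lambda>x. divA x $ i)" for i
    using divA by (auto simp: weak_div_rows_def weak_div_def)
  from rows(1) show "A \<in> borel_measurable borel"
    by (intro measurable_matrix_rows) (simp add: L1_torus_def)
  show "divA \<in> borel_measurable borel"
    unfolding borel_measurable_euclidean_space[of divA]
    using rows(2) by (auto simp: Basis_vec_def inner_axis L1_torus_def)
  show "s \<in> borel_measurable borel" using s by (simp add: L2_torus_def)
qed (auto intro: borel_measurable_continuous_onI continuous)

lemma periodic_A: "periodic A" and periodic_divA: "periodic divA"
proof -
  have rows: "periodic (\<lambda>x. row i (A x))" "periodic (\<lambda>x. divA x $ i)" for i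
    using divA by (auto simp: weak_div_rows_def weak_div_def L1_torus_def)
  then show "periodic A" "periodic divA"
    by (simp_all add: periodic_def row_def vec_eq_iff)
qed

text \<open>The essential bound survives for every single \<open>v\<close>, not just almost every
  one, because reflection about \<open>v\<close> preserves the distribution of \<open>A\<close> on
  the torus.\<close>

lemma AE_A_reflect: "AE w in torus. \<forall>i j. \<bar>A (v - w) $ i $ j\<bar> \<le> a"
  by (rule AE_torus_reflect[where P = "\<lambda>K. \<forall>i j. \<bar>K $ i $ j\<bar> \<le> a"])
    (auto intro: periodic_A A_le)

lemma AE_divA_reflect: "AE w in torus. \<forall>i. \<bar>divA (v - w) $ i\<bar> \<le> b"
  by (rule AE_torus_reflect[where P = "\<lambda>K. \<forall>i. \<bar>K $ i\<bar> \<le> b"])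
    (auto intro: periodic_divA divA_le)

lemma AE_norm_A_mult_le: "AE w in torus. norm (A (v - w) *v y w) \<le> CARD('n) * a * norm (y w)"
  using AE_A_reflect[of v]
proof eventually_elim
  case (elim w)
  then have "\<bar>A (v - w) $ i $ j\<bar> \<le> a" for i j by blast
  then show ?case by (rule norm_matrix_vector_mult_le)
qed

lemma conv_integrable:
  assumes "integrable torus y"
  shows "integrable torus (\<lambda>w. A (v - w) *v y w)"
proof (rule Bochner_Integration.integrable_bound)
  show "integrable torus (\<lambda>w. CARD('n) * a * norm (y w))" using assms by simp
  show "AE w in torus. norm (A (v - w) *v y w) \<le> norm (CARD('n) * a * norm (y w))"
    using AE_norm_A_mult_le[of v y] a_nonneg by simp
  show "(\<lambda>w. A (v - w) *v y w) \<in> borel_measurable torus"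
    using assms by (intro measurable_matrix_vector_mult) auto
qed

lemma conv_add: "integrable torus y \<Longrightarrow> integrable torus z \<Longrightarrow> conv (\<lambda>w. y w + z w) v = conv y v + conv z v"
  by (simp add: conv_def matrix_vector_right_distrib conv_integrable)

lemma conv_diff: "integrable torus y \<Longrightarrow> integrable torus z \<Longrightarrow> conv (\<lambda>w. y w - z w) v = conv y v - conv z v"
  by (simp add: conv_def matrix_vector_mult_diff_distrib conv_integrable)

lemma norm_conv_le:
  assumes "integrable torus y"
  shows "norm (conv y v) \<le> CARD('n) * a * (LINT w|torus. norm (y w))"
proof -
  have "norm (conv y v) \<le> (LINT w|torus. norm (A (v - w) *v y w))"
    unfolding conv_def by (rule integral_norm_bound)
  also have "\<dots> \<le> (LINT w|torus. CARD('n) * a * norm (y w))"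
    using assms by (intro integral_mono_AE AE_norm_A_mult_le) (auto intro: conv_integrable)
  finally show ?thesis by simp
qed

text \<open>The mass \<open>1\<close> of \<open>f\<close> makes the averaged kernel as elliptic as \<open>A\<close>, so no symmetrization in
  \<open>(v, w)\<close> is needed.\<close>

lemma conv_coercive: "lam * (norm r)\<^sup>2 \<le> r \<bullet> conv (\<lambda>w. f w *\<^sub>R r) v"
proof -
  have int: "integrable torus (\<lambda>w. f w *\<^sub>R r)"
    by (intro integrable_torus_continuous continuous_intros continuous)
  have "lam * (norm r)\<^sup>2 = (LINT w|torus. f w * (lam * (norm r)\<^sup>2))"
    using mass by simp
  also have "\<dots> \<le> (LINT w|torus. r \<bullet> (A (v - w) *v (f w *\<^sub>R r)))"
  proof (rule integral_mono)
    show "integrable torus (\<lambda>w. f w * (lam * (norm r)\<^sup>2))"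
      by (intro integrable_torus_continuous continuous_intros continuous)
    show "integrable torus (\<lambda>w. r \<bullet> (A (v - w) *v (f w *\<^sub>R r)))"
      using conv_integrable[OF int] by simp
    show "f w * (lam * (norm r)\<^sup>2) \<le> r \<bullet> (A (v - w) *v (f w *\<^sub>R r))" for w
      using elliptic[of r "v - w"] pos(1)[of w]
      by (simp add: matrix_vector_mult_scaleR mult_left_mono)
  qed
  also have "\<dots> = r \<bullet> conv (\<lambda>w. f w *\<^sub>R r) v"
    unfolding conv_def using conv_integrable[OF int] by (simp add: integral_inner_right)
  finally show ?thesis .
qed

text \<open>The derivatives are moved onto \<open>A\<close>: this is where \<open>divA\<close> enters.\<close>

lemma norm_conv_grad_le: "norm (conv (\<lambda>w. grad f w - grad g w) v) \<le> sqrt (CARD('n)) * (b * N)"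
proof (rule norm_le_sqrt_card)
  fix i
  let ?u = "\<lambda>w. f w - g w"
  let ?\<phi> = "\<lambda>x. ?u (v - x)"
  note u = C1_torus_diff[OF f g] and \<phi> = C1_torus_reflect[OF C1_torus_diff[OF f g], of v]
  have cu: "continuous_on UNIV ?u" by (intro continuous_intros continuous)
  have int: "integrable torus (\<lambda>w. grad f w - grad g w)"
    by (intro integrable_torus_continuous continuous_intros continuous)
  have meas [measurable]: "grad ?\<phi> \<in> borel_measurable borel" "?u \<in> borel_measurable borel"
    by (intro borel_measurable_continuous_onI C1_torusD \<phi> cu)+
  have per: "periodic (\<lambda>x. A x $ i \<bullet> grad ?\<phi> x)" "periodic (\<lambda>x. divA x $ i * ?\<phi> x)"
    using periodic_A periodic_divA C1_torusD(1)[OF \<phi>] periodic_grad[OF \<phi>]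
    unfolding periodic_def by simp_all
  have "conv (\<lambda>w. grad f w - grad g w) v $ i = (LINT w|torus. (A (v - w) *v (grad f w - grad g w)) $ i)"
    unfolding conv_def
    by (rule integral_bounded_linear[OF bounded_linear_vec_nth, symmetric]) (rule conv_integrable[OF int])
  \<comment> \<open>The gradient of the reflected difference, taken at \<open>v - w\<close>, is
    minus the gradient of \<open>f - g\<close> at \<open>w\<close>; the weak divergence below
    contributes the second sign.\<close>
  also have "\<dots> = - (LINT w|torus. A (v - w) $ i \<bullet> grad ?\<phi> (v - w))"
    by (simp add: matrix_vector_mul_component grad_diff[OF f g] grad_reflect[OF u] del: minus_diff_eq)
  also have "\<dots> = - (LINT x|torus. row i (A x) \<bullet> grad ?\<phi> x)"
    by (subst LINT_torus_reflect[OF _ per(1)]) (measurable, simp add: row_def vec_nth_inverse)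
  also have "\<dots> = (LINT x|torus. divA x $ i * ?\<phi> x)"
    using divA \<phi> by (simp add: weak_div_rows_def weak_div_def)
  also have "\<dots> = (LINT w|torus. divA (v - w) $ i * ?\<phi> (v - w))"
    by (rule LINT_torus_reflect[OF _ per(2), symmetric]) measurable
  finally have eq: "conv (\<lambda>w. grad f w - grad g w) v $ i = (LINT w|torus. divA (v - w) $ i * ?u w)"
    by simp
  have int_u: "integrable torus ?u" by (rule integrable_torus_continuous[OF cu])
  have le: "AE w in torus. norm (divA (v - w) $ i * ?u w) \<le> b * \<bar>?u w\<bar>"
    using AE_divA_reflect[of v] by eventually_elim (simp add: abs_mult mult_right_mono)
  have "\<bar>conv (\<lambda>w. grad f w - grad g w) v $ i\<bar> \<le> (LINT w|torus. norm (divA (v - w) $ i * ?u w))"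
    unfolding eq using integral_norm_bound[of torus "\<lambda>w. divA (v - w) $ i * ?u w"] by simp
  also have "\<dots> \<le> (LINT w|torus. b * \<bar>?u w\<bar>)"
  proof (intro integral_mono_AE le)
    show bu: "integrable torus (\<lambda>w. b * \<bar>?u w\<bar>)" using int_u by simp
    show "integrable torus (\<lambda>w. norm (divA (v - w) $ i * ?u w))"
    proof (rule Bochner_Integration.integrable_bound[OF bu])
      show "AE w in torus. norm (norm (divA (v - w) $ i * ?u w)) \<le> norm (b * \<bar>?u w\<bar>)"
        using le by eventually_elim simp
    qed measurable
  qed
  also have "\<dots> = b * N" by (simp add: N_def)
  finally show "\<bar>conv (\<lambda>w. grad f w - grad g w) v $ i\<bar> \<le> b * N" .
qed

lemma err_integrable: "integrable torus err" "integrable torus (\<lambda>v. f v *\<^sub>R err v)"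
  "integrable torus (\<lambda>v. f v * norm (err v))" "integrable torus (\<lambda>v. f v * (norm (err v))\<^sup>2)"
proof -
  show 1: "integrable torus err"
    unfolding err_def
    by (intro Bochner_Integration.integrable_diff s_integrable integrable_torus_continuous continuous)
  then show "integrable torus (\<lambda>v. f v *\<^sub>R err v)"
    by (intro integrable_torus_bounded_scaleR continuous)
  from 1 show "integrable torus (\<lambda>v. f v * norm (err v))"
    using integrable_torus_bounded_scaleR[of f "\<lambda>v. norm (err v)"] by (simp add: continuous)
  have "integrable torus (\<lambda>v. (norm (err v))\<^sup>2)"
  proof (rule Bochner_Integration.integrable_bound)
    show "integrable torus (\<lambda>v. 2 * (norm (score f v))\<^sup>2 + 2 * (norm (s v))\<^sup>2)"
    proof (intro Bochner_Integration.integrable_add integrable_mult_right)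
      show "integrable torus (\<lambda>v. (norm (score f v))\<^sup>2)"
        by (intro integrable_torus_continuous continuous_intros continuous)
      show "integrable torus (\<lambda>v. (norm (s v))\<^sup>2)"
        using s by (simp add: L2_torus_def)
    qed
    show "(\<lambda>v. (norm (err v))\<^sup>2) \<in> borel_measurable torus"
      unfolding err_def by measurable
    show "AE v in torus. norm ((norm (err v))\<^sup>2)
        \<le> norm (2 * (norm (score f v))\<^sup>2 + 2 * (norm (s v))\<^sup>2)"
    proof (intro AE_I2)
      fix v
      \<comment> \<open>The parallelogram law: the squared norms of sum and difference add up to the
        right-hand side of the next line.\<close>
      have "0 \<le> (norm (score f v + s v))\<^sup>2" by simp
      then have "(norm (err v))\<^sup>2 \<le> 2 * (norm (score f v))\<^sup>2 + 2 * (norm (s v))\<^sup>2"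
        by (simp add: err_def power2_norm_eq_inner inner_simps inner_commute)
      then show "norm ((norm (err v))\<^sup>2) \<le> norm (2 * (norm (score f v))\<^sup>2 + 2 * (norm (s v))\<^sup>2)"
        by simp
    qed
  qed
  then show "integrable torus (\<lambda>v. f v * (norm (err v))\<^sup>2)"
    using integrable_torus_bounded_scaleR[of f "\<lambda>v. (norm (err v))\<^sup>2"] by (simp add: continuous)
qed

text \<open>Since \<open>f\<close> is a probability density, this is nonnegativity of the variance
  of \<open>norm (err v)\<close> under it.\<close>

lemma mean_err_le: "(LINT v|torus. f v * norm (err v))\<^sup>2 \<le> E"
proof -
  define m where "m = (LINT v|torus. f v * norm (err v))"
  have f_int: "integrable torus f" by (intro integrable_torus_continuous continuous)
  have "0 \<le> (LINT v|torus. f v * (norm (err v) - m)\<^sup>2)"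
    using pos by (intro Bochner_Integration.integral_nonneg) (simp add: less_imp_le)
  also have "\<dots> = (LINT v|torus. f v * (norm (err v))\<^sup>2 - 2 * m * (f v * norm (err v)) + m\<^sup>2 * f v)"
    by (intro Bochner_Integration.integral_cong refl) (simp add: power2_diff algebra_simps)
  also have "\<dots> = E - 2 * m * m + m\<^sup>2"
    using err_integrable f_int mass by (simp add: E_def m_def)
  finally show ?thesis by (simp add: m_def power2_eq_square)
qed

section \<open>The velocity difference and the dissipation of relative entropy\<close>

lemma velocity_diff:
  fixes v
  defines "r \<equiv> score f v - score g v"
  shows "score_velocity A s f v - landau_velocity A g v
    = conv (\<lambda>w. f w *\<^sub>R err v) v - conv (\<lambda>w. f w *\<^sub>R err w) v
      - conv (\<lambda>w. (f w - g w) *\<^sub>R score g v) v + conv (\<lambda>w. grad f w - grad g w) v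
      - conv (\<lambda>w. f w *\<^sub>R r) v"
proof -
  have const: "integrable torus (\<lambda>w. f w *\<^sub>R c)" "integrable torus (\<lambda>w. g w *\<^sub>R c)"
    "integrable torus (\<lambda>w. (f w - g w) *\<^sub>R c)" for c :: "real ^ 'n"
    by (intro integrable_torus_continuous continuous_intros continuous)+
  have grads: "integrable torus (\<lambda>w. grad f w - grad g w)"
    by (intro integrable_torus_continuous continuous_intros continuous)
  have fs: "integrable torus (\<lambda>w. f w *\<^sub>R (s v - s w))"
    by (intro integrable_torus_bounded_scaleR Bochner_Integration.integrable_diff s_integrable continuous) simp
  have gs: "integrable torus (\<lambda>w. g w *\<^sub>R (score g v - score g w))"
    by (intro integrable_torus_continuous continuous_intros continuous)
  have "score_velocity A s f v - landau_velocity A g v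
      = conv (\<lambda>w. g w *\<^sub>R (score g v - score g w)) v - conv (\<lambda>w. f w *\<^sub>R (s v - s w)) v"
    by (simp add: landau_velocity_def score_velocity_def conv_def matrix_vector_mult_scaleR)
  also have "\<dots> = conv (\<lambda>w. g w *\<^sub>R (score g v - score g w) - f w *\<^sub>R (s v - s w)) v"
    by (simp add: conv_diff fs gs)
  \<comment> \<open>Substitute \<open>s = score f - err\<close> and split
    \<open>g w *\<^sub>R score g v - f w *\<^sub>R score f v\<close> so that \<open>f - g\<close>
    multiplies \<open>score g v\<close>, the score that is bounded by \<open>M\<close>, while the
    rest is the coercive term in \<open>r\<close>.\<close>
  also have "(\<lambda>w. g w *\<^sub>R (score g v - score g w) - f w *\<^sub>R (s v - s w))
      = (\<lambda>w. f w *\<^sub>R err v - f w *\<^sub>R err w - (f w - g w) *\<^sub>R score g v + (grad f w - grad g w)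
          - f w *\<^sub>R r)"
    by (simp add: fun_eq_iff r_def err_def grad_eq algebra_simps)
  finally show ?thesis
    by (simp add: conv_add conv_diff const grads err_integrable)
qed

text \<open>Every term of the velocity difference other than the coercive one is at most
  \<open>norm r\<close> times a quantity free of \<open>r\<close>, so absorption removes
  \<open>r\<close>. The right-hand side then depends on \<open>v\<close> through
  \<open>err v\<close> only.\<close>

lemma dissipation_pointwise:
  fixes v
  defines "r \<equiv> score f v - score g v"
  shows "r \<bullet> (score_velocity A s f v - landau_velocity A g v)
    \<le> ((CARD('n) * a)\<^sup>2 * ((norm (err v))\<^sup>2 + E + M\<^sup>2 * N\<^sup>2) + CARD('n) * b\<^sup>2 * N\<^sup>2) / lam"
proof -
  define da where "da = CARD('n) * a"
  define m where "m = (LINT v|torus. f v * norm (err v))"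
  define R where "R = norm r"
  have da: "da \<ge> 0" using a_nonneg by (simp add: da_def)
  have inner_le: "r \<bullet> y \<le> R * c" "- (r \<bullet> y) \<le> R * c" if "norm y \<le> c" for y c
  proof -
    have "\<bar>r \<bullet> y\<bar> \<le> R * norm y" unfolding R_def by (rule Cauchy_Schwarz_ineq2)
    also have "\<dots> \<le> R * c" unfolding R_def using that by (intro mult_left_mono) auto
    finally show "r \<bullet> y \<le> R * c" "- (r \<bullet> y) \<le> R * c" by auto
  qed
  have "norm (conv (\<lambda>w. f w *\<^sub>R err v) v) \<le> da * (LINT w|torus. norm (f w *\<^sub>R err v))"
    unfolding da_def by (intro norm_conv_le integrable_torus_continuous continuous_intros continuous)
  also have "(LINT w|torus. norm (f w *\<^sub>R err v)) = norm (err v)"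
    using pos(1) mass by (simp add: less_imp_le)
  finally have 1: "norm (conv (\<lambda>w. f w *\<^sub>R err v) v) \<le> da * norm (err v)" .
  have "norm (conv (\<lambda>w. f w *\<^sub>R err w) v) \<le> da * (LINT w|torus. norm (f w *\<^sub>R err w))"
    unfolding da_def by (intro norm_conv_le err_integrable)
  also have "(LINT w|torus. norm (f w *\<^sub>R err w)) = m"
    using pos(1) by (simp add: less_imp_le m_def)
  finally have 2: "norm (conv (\<lambda>w. f w *\<^sub>R err w) v) \<le> da * m" .
  have N: "N \<ge> 0" by (simp add: N_def)
  have "norm (conv (\<lambda>w. (f w - g w) *\<^sub>R score g v) v)
      \<le> da * (LINT w|torus. norm ((f w - g w) *\<^sub>R score g v))"
    unfolding da_def by (intro norm_conv_le integrable_torus_continuous continuous_intros continuous)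
  also have "(LINT w|torus. norm ((f w - g w) *\<^sub>R score g v)) = N * norm (score g v)"
    by (simp add: N_def)
  also have "da * (N * norm (score g v)) \<le> da * (N * M)"
    using da N score_le by (intro mult_left_mono) auto
  finally have 3: "norm (conv (\<lambda>w. (f w - g w) *\<^sub>R score g v) v) \<le> da * (N * M)" .
  have "r \<bullet> (score_velocity A s f v - landau_velocity A g v)
    \<le> R * (da * norm (err v)) + R * (da * m) + R * (da * (N * M)) + R * (sqrt (CARD('n)) * (b * N)) - lam * R\<^sup>2"
    using inner_le(1)[OF 1] inner_le(2)[OF 2] inner_le(2)[OF 3] inner_le(1)[OF norm_conv_grad_le[of v]]
      conv_coercive[of r v]
    unfolding velocity_diff R_def r_def by (simp add: inner_diff_right inner_add_right)
  also have "\<dots> \<le> ((da * norm (err v))\<^sup>2 + (da * m)\<^sup>2 + (da * (N * M))\<^sup>2 + (sqrt (CARD('n)) * (b * N))\<^sup>2) / lam"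
    using lam by (rule young_absorb)
  also have "\<dots> \<le> (da\<^sup>2 * ((norm (err v))\<^sup>2 + E + M\<^sup>2 * N\<^sup>2) + CARD('n) * b\<^sup>2 * N\<^sup>2) / lam"
  proof (intro divide_right_mono)
    \<comment> \<open>The nonlocal error enters through its \<open>f\<close>-mean \<open>m\<close>,
      whose square is at most \<open>E\<close>.\<close>
    have "da\<^sup>2 * m\<^sup>2 \<le> da\<^sup>2 * E" using mean_err_le by (intro mult_left_mono) (auto simp: m_def)
    then show "(da * norm (err v))\<^sup>2 + (da * m)\<^sup>2 + (da * (N * M))\<^sup>2 + (sqrt (CARD('n)) * (b * N))\<^sup>2
        \<le> da\<^sup>2 * ((norm (err v))\<^sup>2 + E + M\<^sup>2 * N\<^sup>2) + CARD('n) * b\<^sup>2 * N\<^sup>2"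
      by (simp add: power_mult_distrib algebra_simps)
  qed (use lam in simp)
  finally show ?thesis by (simp add: da_def)
qed

lemma N_le_KL: "N\<^sup>2 \<le> 2 * KL_div f g"
  unfolding N_def KL_div_def
proof (rule pinsker_inequality[OF pos])
  show "integrable torus f" "integrable torus g" "integrable torus (\<lambda>x. f x * ln (f x / g x))"
    using pos by (auto intro!: integrable_torus_continuous continuous_intros continuous
        simp: less_imp_neq[symmetric])
qed (fact mass)+

text \<open>With \<open>- h\<^sub>1\<close> and \<open>- h\<^sub>2\<close> as time derivatives of
  the two densities, the integrand on the left is the time derivative of
  \<open>f * ln (f / g)\<close>.\<close>

lemma entropy_dissipation:
  assumes h1: "weak_div (\<lambda>v. f v *\<^sub>R score_velocity A s f v) h\<^sub>1"
    and h2: "weak_div (\<lambda>v. g v *\<^sub>R landau_velocity A g v) h\<^sub>2"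
  shows "(LINT v|torus. (f v / g v) * h\<^sub>2 v - (ln (f v / g v) + 1) * h\<^sub>1 v)
    \<le> (2 * CARD('n) / lam * b\<^sup>2 + M\<^sup>2 * (2 * (CARD('n))\<^sup>2 / lam) * a\<^sup>2) * KL_div f g
      + 4 * (CARD('n))\<^sup>2 / lam * a\<^sup>2 * (LINT v|torus. f v * (norm (score f v - s v))\<^sup>2)"
proof -
  let ?U = "score_velocity A s f" and ?V = "landau_velocity A g"
  let ?r = "\<lambda>v. score f v - score g v"
  let ?d = "real CARD('n)"
  note log_ratio = C1_torus_log_ratio[OF f g pos] and ratio = C1_torus_ratio[OF f g pos]
  note grads = grad_log_ratio[OF f g pos] grad_ratio[OF f g pos]
  have fU: "integrable torus (\<lambda>v. f v *\<^sub>R ?U v)" and gV: "integrable torus (\<lambda>v. g v *\<^sub>R ?V v)"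
    and h_int: "integrable torus h\<^sub>1" "integrable torus h\<^sub>2"
    using h1 h2 by (simp_all add: weak_div_def L1_torus_def)
  have h1_int: "integrable torus (\<lambda>v. (ln (f v / g v) + 1) * h\<^sub>1 v)"
    using integrable_torus_bounded_scaleR[OF C1_torusD(4)[OF log_ratio] h_int(1)] by simp
  have h2_int: "integrable torus (\<lambda>v. (f v / g v) * h\<^sub>2 v)"
    using integrable_torus_bounded_scaleR[OF C1_torusD(4)[OF ratio] h_int(2)] by simp
  have fUr: "integrable torus (\<lambda>v. (f v *\<^sub>R ?U v) \<bullet> ?r v)"
    by (intro integrable_torus_inner_continuous fU continuous_intros continuous)
  have gVr: "integrable torus (\<lambda>v. (g v *\<^sub>R ?V v) \<bullet> grad (\<lambda>x. f x / g x) v)"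
    by (intro integrable_torus_inner_continuous gV C1_torusD[OF ratio])
  \<comment> \<open>The gradient of the ratio carries \<open>f / g\<close>, which cancels the weight
    \<open>g\<close>; both fluxes end up weighted by \<open>f\<close> and paired with the same
    vector.\<close>
  have eq: "(f v *\<^sub>R ?U v) \<bullet> ?r v - (g v *\<^sub>R ?V v) \<bullet> grad (\<lambda>x. f x / g x) v = f v * (?r v \<bullet> (?U v - ?V v))" for v
    using pos(2)[of v] by (simp add: grads inner_commute inner_diff_right algebra_simps)
  have fluxes: "(LINT v|torus. (f v *\<^sub>R ?U v) \<bullet> ?r v) = - (LINT v|torus. h\<^sub>1 v * (ln (f v / g v) + 1))"
    "(LINT v|torus. (g v *\<^sub>R ?V v) \<bullet> grad (\<lambda>x. f x / g x) v) = - (LINT v|torus. h\<^sub>2 v * (f v / g v))"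
    using h1[unfolded weak_div_def, THEN conjunct2, THEN conjunct2, rule_format, OF log_ratio]
      h2[unfolded weak_div_def, THEN conjunct2, THEN conjunct2, rule_format, OF ratio]
    by (simp_all only: grads(1))
  \<comment> \<open>The part of the pointwise bound that is constant in \<open>v\<close>; integrated
    against \<open>f\<close>, of mass 1, it stays \<open>c\<close>.\<close>
  define c where "c = ((?d * a)\<^sup>2 * (E + M\<^sup>2 * N\<^sup>2) + ?d * b\<^sup>2 * N\<^sup>2) / lam"
  have f_int: "integrable torus f" by (intro integrable_torus_continuous continuous)
  have "(LINT v|torus. (f v / g v) * h\<^sub>2 v - (ln (f v / g v) + 1) * h\<^sub>1 v)
      = (LINT v|torus. (f v *\<^sub>R ?U v) \<bullet> ?r v) - (LINT v|torus. (g v *\<^sub>R ?V v) \<bullet> grad (\<lambda>x. f x / g x) v)"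
    using fluxes h1_int h2_int by (simp add: mult.commute[of "h\<^sub>1 _"] mult.commute[of "h\<^sub>2 _"])
  also have "\<dots> = (LINT v|torus. f v * (?r v \<bullet> (?U v - ?V v)))"
    using Bochner_Integration.integral_diff[OF fUr gVr] by (simp only: eq)
  also have "\<dots> \<le> (LINT v|torus. (?d * a)\<^sup>2 / lam * (f v * (norm (err v))\<^sup>2) + c * f v)"
  proof (rule integral_mono)
    show "integrable torus (\<lambda>v. f v * (?r v \<bullet> (?U v - ?V v)))"
      using Bochner_Integration.integrable_diff[OF fUr gVr] by (simp only: eq)
    show "integrable torus (\<lambda>v. (?d * a)\<^sup>2 / lam * (f v * (norm (err v))\<^sup>2) + c * f v)"
      using err_integrable f_int by simp
    fix v
    have "f v * (?r v \<bullet> (?U v - ?V v))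
        \<le> f v * (((?d * a)\<^sup>2 * ((norm (err v))\<^sup>2 + E + M\<^sup>2 * N\<^sup>2) + ?d * b\<^sup>2 * N\<^sup>2) / lam)"
      using dissipation_pointwise[of v] pos(1)[of v] by (intro mult_left_mono) auto
    also have "\<dots> = (?d * a)\<^sup>2 / lam * (f v * (norm (err v))\<^sup>2) + c * f v"
      using lam by (simp add: c_def field_simps)
    finally show "f v * (?r v \<bullet> (?U v - ?V v)) \<le> (?d * a)\<^sup>2 / lam * (f v * (norm (err v))\<^sup>2) + c * f v" .
  qed
  also have "\<dots> = (?d * a)\<^sup>2 / lam * E + c"
    using err_integrable f_int mass by (simp add: E_def)
  \<comment> \<open>\<open>E\<close> arises twice, from the local error and from its mean, hence the
    factor 2.\<close>
  also have "\<dots> = 2 * ?d\<^sup>2 / lam * a\<^sup>2 * E + (?d / lam * b\<^sup>2 + M\<^sup>2 * (?d\<^sup>2 / lam) * a\<^sup>2) * N\<^sup>2"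
    using lam by (simp add: c_def field_simps)
  \<comment> \<open>Pinsker's inequality produces the factors 2 in front of the divergence; the
    coefficient of the nonnegative \<open>E\<close> is relaxed from 2 to the stated 4.\<close>
  also have "\<dots> \<le> 4 * ?d\<^sup>2 / lam * a\<^sup>2 * E + (?d / lam * b\<^sup>2 + M\<^sup>2 * (?d\<^sup>2 / lam) * a\<^sup>2) * (2 * KL_div f g)"
  proof (intro add_mono mult_mono N_le_KL order_refl divide_right_mono)
    show "0 \<le> E" using pos(1) unfolding E_def by (intro Bochner_Integration.integral_nonneg) (simp add: less_imp_le)
  qed (use lam in auto)
  also have "\<dots> = (2 * ?d / lam * b\<^sup>2 + M\<^sup>2 * (2 * ?d\<^sup>2 / lam) * a\<^sup>2) * KL_div f g
      + 4 * ?d\<^sup>2 / lam * a\<^sup>2 * (LINT v|torus. f v * (norm (score f v - s v))\<^sup>2)"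
    by (simp add: E_def err_def algebra_simps)
  finally show ?thesis by simp
qed

end

section \<open>Time derivative of the relative entropy along the two solutions\<close>

theorem theorem3p2:
  fixes A :: "real ^ 'n \<Rightarrow> real ^ 'n ^ 'n"
    and divA :: "real ^ 'n \<Rightarrow> real ^ 'n"
    and s :: "real \<Rightarrow> real ^ 'n \<Rightarrow> real ^ 'n"
    and f\<^sub>0 :: "real ^ 'n \<Rightarrow> real"
    and f ft :: "real \<Rightarrow> real ^ 'n \<Rightarrow> real"
    and T lam1 lam2 M :: real
  assumes dim: "CARD('n) \<ge> 2"
    and T: "T > 0"
    and A_sym: "\<And>z. transpose (A z) = A z"
    and A_bdd: "\<And>i j. Linf_torus (\<lambda>z. A z $ i $ j)"
    and divA: "weak_div_rows A divA"
    and divA_bdd: "\<And>i. Linf_torus (\<lambda>z. divA z $ i)"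
    and lam_pos: "0 < lam1" "lam1 \<le> lam2"
    and A_ell: "\<And>z. lam1 *\<^sub>R mat 1 \<preceq> A z" "\<And>z. A z \<preceq> lam2 *\<^sub>R mat 1"
    and f0: "\<And>v. f\<^sub>0 v \<ge> 0" "W2inf_torus f\<^sub>0" "(LINT v|torus. f\<^sub>0 v) = 1"
    and init: "ft 0 = f\<^sub>0" "f 0 = f\<^sub>0"
    and W2inf: "Linf_W2inf T ft" "Linf_W2inf T f"
    and C1: "\<And>t. t \<in> {0..T} \<Longrightarrow> C1_torus (ft t)" "\<And>t. t \<in> {0..T} \<Longrightarrow> C1_torus (f t)"
    and pos: "\<And>t v. t \<in> {0..T} \<Longrightarrow> ft t v > 0" "\<And>t v. t \<in> {0..T} \<Longrightarrow> f t v > 0"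
    and mass: "\<And>t. t \<in> {0..T} \<Longrightarrow> (LINT v|torus. ft t v) = 1"
      "\<And>t. t \<in> {0..T} \<Longrightarrow> (LINT v|torus. f t v) = 1"
    and s_reg: "\<And>t. t \<in> {0..T} \<Longrightarrow> L2_torus (s t)"
    and landau: "solves_landau T A ft"
    and score_landau: "solves_score_landau T A s f"
    and score_bdd: "\<And>t v. t \<in> {0..T} \<Longrightarrow> norm (score (ft t) v) \<le> M"
    and diff_KL: "diff_under_integral T (\<lambda>t v. f t v * ln (f t v / ft t v))"
    and t: "t \<in> {0..T}"
  shows "\<exists>D. ((\<lambda>\<tau>. KL_div (f \<tau>) (ft \<tau>)) has_real_derivative D) (at t within {0..T}) \<and>
    D \<le> (2 * real CARD('n) / lam1 * (vec_Linf_norm divA)\<^sup>2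
            + M\<^sup>2 * (2 * (real CARD('n))\<^sup>2 / lam1) * (mat_Linf_norm A)\<^sup>2) * KL_div (f t) (ft t)
        + 4 * (real CARD('n))\<^sup>2 / lam1 * (mat_Linf_norm A)\<^sup>2
            * (LINT v|torus. f t v * (norm (score (f t) v - s t v))\<^sup>2)"
proof -
  interpret landau_slice A divA "mat_Linf_norm A" "vec_Linf_norm divA" lam1 M "f t" "ft t" "s t"
  proof
    show "AE x in torus. \<forall>i j. \<bar>A x $ i $ j\<bar> \<le> mat_Linf_norm A"
      by (rule AE_le_mat_Linf_norm[OF A_bdd])
    show "AE x in torus. \<forall>i. \<bar>divA x $ i\<bar> \<le> vec_Linf_norm divA"
      by (rule AE_le_vec_Linf_norm[OF divA_bdd])
    fix x z :: "real ^ 'n"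
    have "0 \<le> x \<bullet> ((A z - lam1 *\<^sub>R mat 1) *v x)"
      using A_ell(1)[of z] by (simp add: loewner_le_def)
    then show "lam1 * (norm x)\<^sup>2 \<le> x \<bullet> (A z *v x)"
      by (simp add: matrix_vector_mult_diff_rdistrib inner_diff_right power2_norm_eq_inner
          flip: scaleR_matrix_vector_assoc)
  qed (use C1[OF t] pos[OF t] mass[OF t] divA lam_pos s_reg[OF t] score_bdd[OF t] in auto)
  obtain h\<^sub>1 where h1: "weak_div (\<lambda>v. f t v *\<^sub>R score_velocity A (s t) (f t) v) h\<^sub>1"
    and dt1: "AE v in torus. ((\<lambda>\<tau>. f \<tau> v) has_real_derivative - h\<^sub>1 v) (at t within {0..T})"
    using bspec[OF score_landau[unfolded solves_score_landau_def solves_continuity_def] t] by blast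
  obtain h\<^sub>2 where h2: "weak_div (\<lambda>v. ft t v *\<^sub>R landau_velocity A (ft t) v) h\<^sub>2"
    and dt2: "AE v in torus. ((\<lambda>\<tau>. ft \<tau> v) has_real_derivative - h\<^sub>2 v) (at t within {0..T})"
    using bspec[OF landau[unfolded solves_landau_def solves_continuity_def] t] by blast
  obtain F' where F': "AE v in torus. ((\<lambda>\<tau>. f \<tau> v * ln (f \<tau> v / ft \<tau> v)) has_real_derivative F' v)
      (at t within {0..T})" "integrable torus F'"
    and D: "((\<lambda>\<tau>. KL_div (f \<tau>) (ft \<tau>)) has_real_derivative (LINT v|torus. F' v)) (at t within {0..T})"
    using diff_KL t unfolding diff_under_integral_def KL_div_def by blast
  let ?G = "\<lambda>v. (f t v / ft t v) * h\<^sub>2 v - (ln (f t v / ft t v) + 1) * h\<^sub>1 v"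
  \<comment> \<open>Differentiation under the integral only provides some derivative
    \<open>F'\<close>. The chain rule computes one from the equations, and derivatives within a
    nondegenerate interval are unique, also at its endpoints.\<close>
  have F'_eq: "AE v in torus. F' v = ?G v"
    using F'(1) dt1 dt2
  proof eventually_elim
    case (elim v)
    have p: "f t v > 0" "ft t v > 0" by (rule pos)+
    have "((\<lambda>\<tau>. f \<tau> v * ln (f \<tau> v / ft \<tau> v)) has_real_derivative ?G v) (at t within {0..T})"
      using p by (auto intro!: derivative_eq_intros elim(2,3) simp: field_simps)
    with elim(1) show ?case
      using vector_derivative_unique_within_closed_interval[of 0 T t _ "F' v" "?G v"] T t
      by (simp add: has_real_derivative_iff_has_vector_derivative)
  qed
  have [measurable]: "h\<^sub>1 \<in> borel_measurable borel" "h\<^sub>2 \<in> borel_measurable borel"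
    using h1 h2 by (auto simp: weak_div_def L1_torus_def)
  have "(LINT v|torus. F' v) = (LINT v|torus. ?G v)"
    using F' by (intro integral_cong_AE F'_eq) auto
  also note entropy_dissipation[OF h1 h2]
  finally show ?thesis using D by (intro exI[of _ "LINT v|torus. F' v"] conjI) auto
qed

end
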